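(* For every integer $d\geq 3$ there exists $Q(d)$ such that for every prime power $q\geq Q(d)$ there is a totally chiral hypermap with monodromy group isomorphic to $SL_d(q)$ and a totally chiral hypermap with monodromy group isomorphic to $PSL_d(q)$.
   Context: Let $\Delta=\langle r_0,r_1,r_2\mid r_0^2=r_1^2=r_2^2=1\rangle$ and let $\Delta^+$ be its index-$2$ subgroup of even-length words, generated by $\rho=r_1r_2$ and $\lambda=r_2r_0$. An (oriented) hypermap is a triple $\mathcal H=(D,R,L)$ with $D$ a finite set and $R,L$ permutations of $D$ such that the monodromy group $\mathrm{Mon}(\mathcal H)=\langle R,L\rangle$ is transitive on $D$. It is orientably regular if its automorphism group (permutations of $D$ commuting with $R$ and $L$) acts regularly on $D$; then $\mathcal H\cong(\Delta^+/H,\rho,\lambda)$ (left multiplication on cosets) for a unique normal subgroup $H$ of finite index in $\Delta^+$ (the hypermap subgroup), and $\mathrm{Mon}(\mathcal H)\cong\Delta^+/H$. For $H\trianglelefteq\Delta^+$ put $H^r=r_2Hr_2$. An orientably regular hypermap is totally chiral if $HH^r=\Delta^+$, i.e. its chirality group $HH^r/H$ equals its whole monodromy group $\Delta^+/H$. *)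

theory Defs
  imports
    "HOL-Algebra.Algebra"
    "HOL-Algebra.Left_Coset"
    "HOL-Number_Theory.Prime_Powers"
    "Jordan_Normal_Form.Matrix"
begin

section \<open>The group \<open>\<Delta>\<close> and its even subgroup\<close>

datatype gen = G0 | G1 | G2

text \<open>
  The defining relations make every generator its own inverse, so
  \<open>\<Delta>\<close> is the free monoid on the generators modulo the congruence
  generated by \<open>r\<^sub>i r\<^sub>i = 1\<close>.
\<close>

inductive word_rel :: "gen list \<Rightarrow> gen list \<Rightarrow> bool" where
  wr_cancel: "word_rel (u @ [x, x] @ v) (u @ v)"
| wr_refl: "word_rel u u"
| wr_sym: "word_rel u v \<Longrightarrow> word_rel v u"
| wr_trans: "word_rel u v \<Longrightarrow> word_rel v w \<Longrightarrow> word_rel u w"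

lemma word_rel_context: "word_rel u v \<Longrightarrow> word_rel (a @ u @ b) (a @ v @ b)"
proof (induction rule: word_rel.induct)
  case (wr_cancel u x v)
  show ?case using word_rel.wr_cancel[of "a @ u" x "v @ b"] by simp
qed (auto intro: word_rel.intros)

lemma word_rel_append:
  assumes "word_rel u u'" "word_rel v v'"
  shows "word_rel (u @ v) (u' @ v')"
proof -
  have "word_rel (u @ v) (u' @ v)"
    using word_rel_context[OF assms(1), of "[]" v] by simp
  moreover have "word_rel (u' @ v) (u' @ v')"
    using word_rel_context[OF assms(2), of u' "[]"] by simp
  ultimately show ?thesis by (rule wr_trans)
qed

lemma word_rel_even: "word_rel u v \<Longrightarrow> even (length u) \<longleftrightarrow> even (length v)"
  by (induction rule: word_rel.induct) auto

lemma equivp_word_rel: "equivp word_rel"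
  by (rule equivpI) (auto simp: reflp_def symp_def transp_def intro: word_rel.intros)

quotient_type delta = "gen list" / word_rel
  by (rule equivp_word_rel)

lift_definition delta_mult :: "delta \<Rightarrow> delta \<Rightarrow> delta" is "(@)"
  by (rule word_rel_append)

lift_definition delta_one :: delta is "[]" .

lift_definition delta_gen :: "gen \<Rightarrow> delta" is "\<lambda>x. [x]" .

lift_definition delta_even :: "delta \<Rightarrow> bool" is "\<lambda>w. even (length w)"
  by (rule word_rel_even)

definition Delta :: "delta monoid" where
  "Delta = \<lparr>carrier = UNIV, monoid.mult = delta_mult, one = delta_one\<rparr>"

definition r0 :: delta where "r0 = delta_gen G0"
definition r1 :: delta where "r1 = delta_gen G1"
definition r2 :: delta where "r2 = delta_gen G2"

definition Delta_plus :: "delta monoid" where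
  "Delta_plus = Delta\<lparr>carrier := {x. delta_even x}\<rparr>"

definition rho :: delta where "rho = r1 \<otimes>\<^bsub>Delta\<^esub> r2"
definition lam :: delta where "lam = r2 \<otimes>\<^bsub>Delta\<^esub> r0"

lemma word_rel_rev: "word_rel (rev w @ w) []"
proof (induction w)
  case Nil
  show ?case by (simp add: wr_refl)
next
  case (Cons x w)
  have "word_rel (rev w @ [x, x] @ w) (rev w @ w)" by (rule wr_cancel)
  with Cons show ?case by (auto intro: wr_trans)
qed

lemma delta_mult_assoc: "delta_mult (delta_mult x y) z = delta_mult x (delta_mult y z)"
  by transfer (simp add: wr_refl)

lemma delta_mult_one: "delta_mult delta_one x = x"
  by transfer (simp add: wr_refl)

lemma delta_mult_inverse: "\<exists>y. delta_mult y x = delta_one"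
  by transfer (blast intro: word_rel_rev)

lemma group_Delta: "group Delta"
  by (rule groupI)
    (simp_all add: Delta_def delta_mult_assoc delta_mult_one delta_mult_inverse)

lemma delta_gen_involution: "delta_mult (delta_gen x) (delta_gen x) = delta_one"
  by transfer (use wr_cancel[of "[]" _ "[]"] in simp)

lemma delta_even_one: "delta_even delta_one"
  by transfer simp

lemma delta_even_mult:
  "delta_even (delta_mult x y) \<longleftrightarrow> (delta_even x \<longleftrightarrow> delta_even y)"
  by transfer simp

lemma subgroup_Delta_plus: "subgroup (carrier Delta_plus) Delta"
proof (rule group.subgroupI[OF group_Delta])
  fix a assume a: "a \<in> carrier Delta_plus"
  have "inv\<^bsub>Delta\<^esub> a \<otimes>\<^bsub>Delta\<^esub> a = \<one>\<^bsub>Delta\<^esub>"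
    by (rule group.l_inv[OF group_Delta]) (simp add: Delta_def)
  then have "delta_mult (inv\<^bsub>Delta\<^esub> a) a = delta_one" by (simp add: Delta_def)
  then have "delta_even (inv\<^bsub>Delta\<^esub> a) \<longleftrightarrow> delta_even a"
    by (metis delta_even_mult delta_even_one)
  with a show "inv\<^bsub>Delta\<^esub> a \<in> carrier Delta_plus" by (simp add: Delta_plus_def)
next
  fix a b assume "a \<in> carrier Delta_plus" "b \<in> carrier Delta_plus"
  then show "a \<otimes>\<^bsub>Delta\<^esub> b \<in> carrier Delta_plus"
    by (simp add: Delta_plus_def Delta_def delta_even_mult)
next
  show "carrier Delta_plus \<noteq> {}" using delta_even_one by (auto simp: Delta_plus_def)
qed (simp add: Delta_def)

lemma rho_lam_Delta_plus: "rho \<in> carrier Delta_plus" "lam \<in> carrier Delta_plus"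
  unfolding rho_def lam_def r0_def r1_def r2_def Delta_plus_def Delta_def
  by (simp; transfer; simp)+


section \<open>Oriented hypermaps\<close>

record 'a hypermap =
  darts :: "'a set"
  permR :: "'a \<Rightarrow> 'a"
  permL :: "'a \<Rightarrow> 'a"

definition Mon :: "'a hypermap \<Rightarrow> ('a \<Rightarrow> 'a) monoid" where
  "Mon M = (BijGroup (darts M))
     \<lparr>carrier := generate (BijGroup (darts M)) {permR M, permL M}\<rparr>"

definition is_hypermap :: "'a hypermap \<Rightarrow> bool" where
  "is_hypermap M \<longleftrightarrow>
     finite (darts M) \<and> darts M \<noteq> {} \<and>
     permR M \<in> Bij (darts M) \<and> permL M \<in> Bij (darts M) \<and>
     (\<forall>x\<in>darts M. \<forall>y\<in>darts M. \<exists>g\<in>carrier (Mon M). g x = y)"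

definition hypermap_aut :: "'a hypermap \<Rightarrow> ('a \<Rightarrow> 'a) set" where
  "hypermap_aut M = {f \<in> Bij (darts M).
     \<forall>x\<in>darts M. f (permR M x) = permR M (f x) \<and> f (permL M x) = permL M (f x)}"

definition orientably_regular :: "'a hypermap \<Rightarrow> bool" where
  "orientably_regular M \<longleftrightarrow>
     is_hypermap M \<and> (\<forall>x\<in>darts M. \<forall>y\<in>darts M. \<exists>!f. f \<in> hypermap_aut M \<and> f x = y)"

definition hypermap_iso :: "'a hypermap \<Rightarrow> 'b hypermap \<Rightarrow> bool" where
  "hypermap_iso M N \<longleftrightarrow> (\<exists>f. bij_betw f (darts M) (darts N) \<and>
     (\<forall>x\<in>darts M. f (permR M x) = permR N (f x) \<and> f (permL M x) = permL N (f x)))"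

definition coset_hypermap :: "delta set \<Rightarrow> delta set hypermap" where
  "coset_hypermap H =
     \<lparr>darts = lcosets\<^bsub>Delta_plus\<^esub> H,
      permR = (\<lambda>C\<in>lcosets\<^bsub>Delta_plus\<^esub> H. rho <#\<^bsub>Delta_plus\<^esub> C),
      permL = (\<lambda>C\<in>lcosets\<^bsub>Delta_plus\<^esub> H. lam <#\<^bsub>Delta_plus\<^esub> C)\<rparr>"

definition is_hypermap_subgroup :: "'a hypermap \<Rightarrow> delta set \<Rightarrow> bool" where
  "is_hypermap_subgroup M H \<longleftrightarrow>
     H \<lhd> Delta_plus \<and> finite (lcosets\<^bsub>Delta_plus\<^esub> H) \<and> hypermap_iso M (coset_hypermap H)"

definition conj_r2 :: "delta set \<Rightarrow> delta set" where
  "conj_r2 H = r2 <#\<^bsub>Delta\<^esub> H #>\<^bsub>Delta\<^esub> r2"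

text \<open>
  An orientably regular hypermap has exactly one hypermap subgroup, so the
  existential quantifier below refers to that subgroup.
\<close>

definition totally_chiral :: "'a hypermap \<Rightarrow> bool" where
  "totally_chiral M \<longleftrightarrow> orientably_regular M \<and>
     (\<exists>H. is_hypermap_subgroup M H \<and> H <#>\<^bsub>Delta\<^esub> conj_r2 H = carrier Delta_plus)"


section \<open>Special linear groups over a field given by its carrier\<close>

text \<open>
  Fields are those of HOL-Algebra, so that the order of the field can be
  quantified inside a formula.  The type of matrices serves only as a container
  of entries: the operations on the entry type play no role.
\<close>

definition mat_over :: "('a, 'm) ring_scheme \<Rightarrow> nat \<Rightarrow> 'a mat set" where
  "mat_over F d = {A \<in> carrier_mat d d. \<forall>i<d. \<forall>j<d. A $$ (i, j) \<in> carrier F}"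

definition mult_over :: "('a, 'm) ring_scheme \<Rightarrow> nat \<Rightarrow> 'a mat \<Rightarrow> 'a mat \<Rightarrow> 'a mat" where
  "mult_over F d A B = mat d d
     (\<lambda>(i, j). \<Oplus>\<^bsub>F\<^esub>k\<in>{..<d}. A $$ (i, k) \<otimes>\<^bsub>F\<^esub> B $$ (k, j))"

definition one_over :: "('a, 'm) ring_scheme \<Rightarrow> nat \<Rightarrow> 'a mat" where
  "one_over F d = mat d d (\<lambda>(i, j). if i = j then \<one>\<^bsub>F\<^esub> else \<zero>\<^bsub>F\<^esub>)"

definition det_over :: "('a, 'm) ring_scheme \<Rightarrow> nat \<Rightarrow> 'a mat \<Rightarrow> 'a" where
  "det_over F d A = (\<Oplus>\<^bsub>F\<^esub>p\<in>{p. p permutes {..<d}}.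
     (if evenperm p then \<one>\<^bsub>F\<^esub> else \<ominus>\<^bsub>F\<^esub> \<one>\<^bsub>F\<^esub>) \<otimes>\<^bsub>F\<^esub>
     (\<Otimes>\<^bsub>F\<^esub>i\<in>{..<d}. A $$ (i, p i)))"

definition SL :: "nat \<Rightarrow> ('a, 'm) ring_scheme \<Rightarrow> 'a mat monoid" where
  "SL d F = \<lparr>carrier = {A \<in> mat_over F d. det_over F d A = \<one>\<^bsub>F\<^esub>},
             monoid.mult = mult_over F d, one = one_over F d\<rparr>"

definition group_center :: "('a, 'm) monoid_scheme \<Rightarrow> 'a set" where
  "group_center G = {z \<in> carrier G. \<forall>g\<in>carrier G. z \<otimes>\<^bsub>G\<^esub> g = g \<otimes>\<^bsub>G\<^esub> z}"

definition PSL :: "nat \<Rightarrow> ('a, 'm) ring_scheme \<Rightarrow> 'a mat set monoid" where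
  "PSL d F = SL d F Mod group_center (SL d F)"

end

(*
Delta^+ is free on rho and lambda, and conjugation by r_2 inverts both generators.  For a group G
generated by x and y, the hypermap with Delta^+/H = G, rho = x, lambda = y is therefore totally
chiral as soon as some element of Delta^+ is trivial at (x, y) while its value at (x^-1, y^-1)
has normal closure G; this property passes to quotients of G, so PSL_d(q) follows from SL_d(q).

Let a be a primitive element of the field, T(s) = 1 + s E_01 and x = diag(1, a^-1, 1, ..., 1, a),
and let y = T(1) w with w a monomial d-cycle of determinant 1.  With g1 = x and g2 = y x y^-1 the
commutator c = [g1, g2] is T(s) for some s /= 0, and x acts on T(F) as multiplication by a.  Hence
<x, y> contains T(F), then w, then all transvections.  If 1 + a = a^n, then
c * (g1 c g1^-1) = g1^n c g1^-n.  Both x and w x w^-1 scale T(F) by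
the same factor a, so for the inverse pair the same word yields, up to conjugation, the
transvection T(s' (1 + a^-1 - a^-n)) with s' /= 0.  It is nontrivial since 1 + a + a^2 /= 0
when q >= 5, and its normal closure is all of SL_d(q).
*)
theory Submission
  imports Defs
begin

section \<open>Homomorphisms from the even subgroup\<close>

text \<open>The word has to survive a swap of roles. At the inverse pair g2 is y^-1 x^-1 y, which
  involves another root subgroup; conjugating by y replaces (g1, g2) by the inverses of (g2, g1) as
  taken at the original pair, so that it is now y x y^-1 whose action on T(F) matters. Hence the
  demand that x and w x w^-1 scale T(F) alike. For x = diag(x_0, ..., x_(d-1)) it reads x_0/x_1 =
  x_(d-1)/x_0 = a; with x_0 = 1 this fixes x_1 = a^-1 and x_(d-1) = a, and determinant 1 then allows
  ones elsewhere. The positions 1 and d - 1 differ because d is at least 3. The factor T(1) in y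
  makes c nontrivial: x and w x w^-1 are diagonal and commute. Primitivity of a serves twice:
  conjugates of one nontrivial T(s) exhaust T(F) up to the identity, and 1 + a, being nonzero, is a
  power of a. The bound on q only guarantees that a has order at least 4, so it does not depend on
  d.\<close>

text \<open>
  The alternating product \<open>f a \<otimes> inv f b \<otimes> f c \<otimes> \<dots>\<close> is compatible with the relations
  \<open>r\<^sub>i r\<^sub>i = 1\<close> for every \<open>f\<close>, so it is defined on all of \<open>\<Delta>\<close>; it is a homomorphism
  on \<open>\<Delta>\<^sup>+\<close> only.  Conjugation by \<open>r\<^sub>2\<close> replaces \<open>f\<close> by its inverse, provided \<open>f G2 = \<one>\<close>.
\<close>

fun word_eval :: "('a, 'm) monoid_scheme \<Rightarrow> (gen \<Rightarrow> 'a) \<Rightarrow> gen list \<Rightarrow> 'a" where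
  "word_eval G f [] = \<one>\<^bsub>G\<^esub>"
| "word_eval G f (a # l) = f a \<otimes>\<^bsub>G\<^esub> word_eval G (\<lambda>b. inv\<^bsub>G\<^esub> f b) l"

text \<open>With \<open>G2\<close> sent to the identity, r1 r2 evaluates to the value of
  \<open>G1\<close> and r2 r0 to the inverse of the value of \<open>G0\<close>; this dictates x and
  the inverse of y.\<close>

definition gen_image :: "('a, 'm) monoid_scheme \<Rightarrow> 'a \<Rightarrow> 'a \<Rightarrow> gen \<Rightarrow> 'a" where
  "gen_image G x y a = (case a of G0 \<Rightarrow> inv\<^bsub>G\<^esub> y | G1 \<Rightarrow> x | G2 \<Rightarrow> \<one>\<^bsub>G\<^esub>)"

text \<open>A representative is chosen instead of lifting \<open>word_eval\<close>, because the
  evaluation respects \<open>word_rel\<close> only in a group and for values in its carrier.\<close>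

definition delta_hom :: "('a, 'm) monoid_scheme \<Rightarrow> 'a \<Rightarrow> 'a \<Rightarrow> delta \<Rightarrow> 'a" where
  "delta_hom G x y z = word_eval G (gen_image G x y) (rep_delta z)"

context group
begin

lemma word_eval_closed: "range f \<subseteq> carrier G \<Longrightarrow> word_eval G f w \<in> carrier G"
proof (induction w arbitrary: f)
  case (Cons a w)
  have "range (\<lambda>b. inv f b) \<subseteq> carrier G" using Cons.prems by auto
  with Cons show ?case by (auto simp: range_subsetD)
qed simp

lemma word_eval_inv_inv:
  assumes "range f \<subseteq> carrier G"
  shows "(\<lambda>b. inv (inv f b)) = f"
  using assms by (auto simp: range_subsetD)

lemma word_eval_append:
  "range f \<subseteq> carrier G \<Longrightarrow> word_eval G f (u @ v) =
    word_eval G f u \<otimes> word_eval G (if even (length u) then f else (\<lambda>b. inv f b)) v"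
proof (induction u arbitrary: f)
  case Nil
  then show ?case by (simp add: word_eval_closed)
next
  case (Cons a u)
  have r: "range (\<lambda>b. inv f b) \<subseteq> carrier G" using Cons.prems by auto
  then show ?case
    using Cons word_eval_inv_inv[OF Cons.prems]
    by (simp add: m_assoc word_eval_closed range_subsetD)
qed

lemma word_eval_cancel:
  assumes "range f \<subseteq> carrier G"
  shows "word_eval G f ([a, a] @ v) = word_eval G f v"
proof -
  have "f a \<in> carrier G" using assms by auto
  then show ?thesis
    by (simp add: word_eval_inv_inv[OF assms] word_eval_closed assms m_assoc[symmetric])
qed

text \<open>A cancelled pair contributes f x times its inverse, or the same in the opposite order
  after an odd prefix. Having even length, it leaves the alternation behind it unchanged.\<close>

lemma word_eval_word_rel:
  "word_rel u v \<Longrightarrow> range f \<subseteq> carrier G \<Longrightarrow> word_eval G f u = word_eval G f v"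
proof (induction rule: word_rel.induct)
  case (wr_cancel u x v)
  have r: "range (\<lambda>b. inv f b) \<subseteq> carrier G" using wr_cancel by auto
  show ?case
    unfolding word_eval_append[OF wr_cancel]
    using word_eval_cancel[OF r] word_eval_cancel[OF wr_cancel] by simp
qed auto

lemma gen_image_closed:
  "x \<in> carrier G \<Longrightarrow> y \<in> carrier G \<Longrightarrow> range (gen_image G x y) \<subseteq> carrier G"
  by (auto simp: gen_image_def split: gen.splits)

lemma inv_gen_image:
  "x \<in> carrier G \<Longrightarrow> y \<in> carrier G \<Longrightarrow>
    (\<lambda>b. inv gen_image G x y b) = gen_image G (inv x) (inv y)"
  by (auto simp: gen_image_def fun_eq_iff split: gen.splits)

lemma delta_hom_abs:
  assumes "x \<in> carrier G" "y \<in> carrier G"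
  shows "delta_hom G x y (abs_delta w) = word_eval G (gen_image G x y) w"
proof -
  have "word_rel (rep_delta (abs_delta w)) w"
    using Quotient3_abs_rep[OF Quotient3_delta] Quotient3_rel[OF Quotient3_delta]
    by (metis wr_refl)
  then show ?thesis
    unfolding delta_hom_def by (rule word_eval_word_rel[OF _ gen_image_closed[OF assms]])
qed

lemma delta_hom_closed:
  "x \<in> carrier G \<Longrightarrow> y \<in> carrier G \<Longrightarrow> delta_hom G x y z \<in> carrier G"
  unfolding delta_hom_def by (intro word_eval_closed gen_image_closed)

text \<open>An odd left factor shifts the alternation by one place, which amounts to evaluating the
  right factor at the inverse pair.\<close>

lemma delta_hom_mult:
  assumes "x \<in> carrier G" "y \<in> carrier G"
  shows "delta_hom G x y (delta_mult u v) = delta_hom G x y u \<otimes>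
    (if delta_even u then delta_hom G x y v else delta_hom G (inv x) (inv y) v)"
proof -
  obtain a b where "u = abs_delta a" "v = abs_delta b"
    by (metis Quotient3_abs_rep[OF Quotient3_delta])
  then show ?thesis
    using assms by (simp add: delta_mult.abs_eq delta_even.abs_eq delta_hom_abs
        word_eval_append gen_image_closed inv_gen_image)
qed

lemma delta_hom_hom:
  "x \<in> carrier G \<Longrightarrow> y \<in> carrier G \<Longrightarrow> delta_hom G x y \<in> hom Delta_plus G"
  by (rule homI) (auto simp: Delta_plus_def Delta_def delta_hom_closed delta_hom_mult)

lemma delta_hom_gen:
  assumes "x \<in> carrier G" "y \<in> carrier G"
  shows "delta_hom G x y rho = x" "delta_hom G x y lam = y" "delta_hom G x y r2 = \<one>"
  using assms unfolding rho_def lam_def r0_def r1_def r2_def delta_gen_def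
  by (simp_all add: Delta_def delta_mult.abs_eq delta_hom_abs gen_image_def)

text \<open>Both copies of \<open>r2\<close> have value one, but the first shifts the alternation
  for z. Thus evaluating H^r at (x, y) is evaluating H at the inverse pair.\<close>

lemma delta_hom_conj_r2:
  assumes "x \<in> carrier G" "y \<in> carrier G" "delta_even z"
  shows "delta_hom G x y (delta_mult (delta_mult r2 z) r2) = delta_hom G (inv x) (inv y) z"
proof -
  have o: "\<not> delta_even r2" unfolding r2_def delta_gen_def by (simp add: delta_even.abs_eq)
  show ?thesis using assms o
    by (simp add: delta_hom_mult delta_even_mult delta_hom_gen delta_hom_closed)
qed

end

lemma group_Delta_plus: "group Delta_plus"
proof -
  have "Delta_plus = Delta\<lparr>carrier := carrier Delta_plus\<rparr>" by (simp add: Delta_plus_def)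
  then show ?thesis
    using group.subgroup_imp_group[OF group_Delta subgroup_Delta_plus] by metis
qed

lemma hom_comp_delta_hom:
  assumes "group_hom G K p" "x \<in> carrier G" "y \<in> carrier G"
  shows "delta_hom K (p x) (p y) z = p (delta_hom G x y z)"
proof -
  interpret group_hom G K p by fact
  have we: "range f \<subseteq> carrier G \<Longrightarrow> p (word_eval G f w) = word_eval K (\<lambda>a. p (f a)) w" for f w
  proof (induction w arbitrary: f)
    case (Cons a w)
    have r: "range (\<lambda>b. inv\<^bsub>G\<^esub> f b) \<subseteq> carrier G" using Cons.prems by auto
    have "(\<lambda>b. p (inv\<^bsub>G\<^esub> f b)) = (\<lambda>b. inv\<^bsub>K\<^esub> p (f b))"
      using Cons.prems by (auto simp: fun_eq_iff range_subsetD)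
    with Cons.IH[OF r] show ?case
      using Cons.prems G.word_eval_closed[OF r] by (simp add: range_subsetD)
  qed simp
  have "(\<lambda>a. p (gen_image G x y a)) = gen_image K (p x) (p y)"
    using assms(2,3) by (auto simp: gen_image_def fun_eq_iff split: gen.splits)
  then show ?thesis
    by (simp add: delta_hom_def we[OF G.gen_image_closed[OF assms(2,3)]])
qed

text \<open>For H the kernel, the last clause says that H^r maps onto Delta^+/H = G, which is H H^r
  = Delta^+. Phrased with the image of a whole kernel, it passes to quotients without any mention of
  normal closures.\<close>

definition chiral_pair :: "('a, 'm) monoid_scheme \<Rightarrow> 'a \<Rightarrow> 'a \<Rightarrow> bool" where
  "chiral_pair G x y \<longleftrightarrow> x \<in> carrier G \<and> y \<in> carrier G \<and> generate G {x, y} = carrier G \<and>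
     delta_hom G (inv\<^bsub>G\<^esub> x) (inv\<^bsub>G\<^esub> y) ` kernel Delta_plus G (delta_hom G x y) = carrier G"

text \<open>The kernel for G is contained in the kernel for K, so preimages found for elements of G
  serve for their images in K.\<close>

lemma chiral_pair_image:
  assumes "group_hom G K p" "p ` carrier G = carrier K" "chiral_pair G x y"
  shows "chiral_pair K (p x) (p y)"
proof -
  interpret group_hom G K p by fact
  have xy: "x \<in> carrier G" "y \<in> carrier G" and gen: "generate G {x, y} = carrier G"
    and c: "delta_hom G (inv\<^bsub>G\<^esub> x) (inv\<^bsub>G\<^esub> y) ` kernel Delta_plus G (delta_hom G x y) = carrier G"
    using assms(3) by (auto simp: chiral_pair_def)
  have g: "generate K {p x, p y} = carrier K"
    using generate_img[of "{x, y}"] xy gen assms(2) by simp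
  have psi: "delta_hom K (inv\<^bsub>K\<^esub> p x) (inv\<^bsub>K\<^esub> p y) z
      = p (delta_hom G (inv\<^bsub>G\<^esub> x) (inv\<^bsub>G\<^esub> y) z)" for z
    using hom_comp_delta_hom[OF assms(1), of "inv\<^bsub>G\<^esub> x" "inv\<^bsub>G\<^esub> y" z] xy by simp
  have "carrier K \<subseteq> delta_hom K (inv\<^bsub>K\<^esub> p x) (inv\<^bsub>K\<^esub> p y) `
      kernel Delta_plus K (delta_hom K (p x) (p y))"
  proof
    fix k assume "k \<in> carrier K"
    then obtain g where g: "g \<in> carrier G" "k = p g" using assms(2) by auto
    then obtain z where z: "z \<in> kernel Delta_plus G (delta_hom G x y)"
      "g = delta_hom G (inv\<^bsub>G\<^esub> x) (inv\<^bsub>G\<^esub> y) z" using c by blast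
    have "z \<in> kernel Delta_plus K (delta_hom K (p x) (p y))"
      using z(1) by (simp add: kernel_def hom_comp_delta_hom[OF assms(1) xy])
    then show "k \<in> delta_hom K (inv\<^bsub>K\<^esub> p x) (inv\<^bsub>K\<^esub> p y) `
      kernel Delta_plus K (delta_hom K (p x) (p y))"
      using g z(2) by (auto simp: psi)
  qed
  moreover have "delta_hom K (inv\<^bsub>K\<^esub> p x) (inv\<^bsub>K\<^esub> p y) `
      kernel Delta_plus K (delta_hom K (p x) (p y)) \<subseteq> carrier K"
    using xy by (auto intro!: H.delta_hom_closed)
  ultimately show ?thesis
    using xy g by (auto simp: chiral_pair_def)
qed

section \<open>Hypermaps of chiral generating pairs\<close>

definition cayley_hypermap :: "('a, 'm) monoid_scheme \<Rightarrow> 'a \<Rightarrow> 'a \<Rightarrow> 'a hypermap" where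
  "cayley_hypermap G x y = \<lparr>darts = carrier G,
     permR = (\<lambda>u\<in>carrier G. x \<otimes>\<^bsub>G\<^esub> u), permL = (\<lambda>u\<in>carrier G. y \<otimes>\<^bsub>G\<^esub> u)\<rparr>"

context group
begin

lemma left_mult_Bij: "g \<in> carrier G \<Longrightarrow> (\<lambda>u\<in>carrier G. g \<otimes> u) \<in> Bij (carrier G)"
proof -
  assume g: "g \<in> carrier G"
  have "bij_betw (\<lambda>u. g \<otimes> u) (carrier G) (carrier G)"
    by (rule bij_betwI[of _ _ _ "\<lambda>u. inv g \<otimes> u"]) (use g in \<open>auto simp: m_assoc[symmetric]\<close>)
  then show ?thesis by (simp add: Bij_def bij_betw_restrict_eq)
qed

lemma right_mult_Bij: "g \<in> carrier G \<Longrightarrow> (\<lambda>u\<in>carrier G. u \<otimes> g) \<in> Bij (carrier G)"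
proof -
  assume g: "g \<in> carrier G"
  have "bij_betw (\<lambda>u. u \<otimes> g) (carrier G) (carrier G)"
    by (rule bij_betwI[of _ _ _ "\<lambda>u. u \<otimes> inv g"]) (use g in \<open>auto simp: m_assoc\<close>)
  then show ?thesis by (simp add: Bij_def bij_betw_restrict_eq)
qed

lemma left_mult_hom:
  "(\<lambda>g. \<lambda>u\<in>carrier G. g \<otimes> u) \<in> hom G (BijGroup (carrier G))"
proof (rule homI)
  fix g h assume gh: "g \<in> carrier G" "h \<in> carrier G"
  show "(\<lambda>u\<in>carrier G. g \<otimes> h \<otimes> u) =
      (\<lambda>u\<in>carrier G. g \<otimes> u) \<otimes>\<^bsub>BijGroup (carrier G)\<^esub> (\<lambda>u\<in>carrier G. h \<otimes> u)"
    using gh left_mult_Bij[OF gh(1)] left_mult_Bij[OF gh(2)]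
    by (auto simp: BijGroup_def compose_def m_assoc fun_eq_iff)
qed (simp add: BijGroup_def left_mult_Bij)

context
  fixes x y
  assumes xy: "x \<in> carrier G" "y \<in> carrier G" and gen: "generate G {x, y} = carrier G"
begin

text \<open>Left translation is a homomorphism into \<open>BijGroup\<close>, so it maps the subgroup
  generated by x and y onto the one generated by their translations.\<close>

lemma carrier_Mon_cayley:
  "carrier (Mon (cayley_hypermap G x y)) = (\<lambda>g. \<lambda>u\<in>carrier G. g \<otimes> u) ` carrier G"
proof -
  interpret L: group_hom G "BijGroup (carrier G)" "\<lambda>g. \<lambda>u\<in>carrier G. g \<otimes> u"
    by (intro group_hom.intro group_hom_axioms.intro left_mult_hom group_BijGroup group_axioms)
  show ?thesis
    using L.generate_img[of "{x, y}"] xy gen by (simp add: Mon_def cayley_hypermap_def)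
qed

lemma Mon_cayley_iso: "Mon (cayley_hypermap G x y) \<cong> G"
proof -
  let ?L = "\<lambda>g. \<lambda>u\<in>carrier G. g \<otimes> u"
  have "?L \<in> hom G (Mon (cayley_hypermap G x y))"
  proof (rule homI)
    fix g h assume "g \<in> carrier G" "h \<in> carrier G"
    then show "?L (g \<otimes> h) = ?L g \<otimes>\<^bsub>Mon (cayley_hypermap G x y)\<^esub> ?L h"
      using hom_mult[OF left_mult_hom] by (simp add: Mon_def cayley_hypermap_def)
  qed (use carrier_Mon_cayley in blast)
  moreover have "inj_on ?L (carrier G)"
  proof (rule inj_onI)
    fix g h assume gh: "g \<in> carrier G" "h \<in> carrier G" "?L g = ?L h"
    have "?L g \<one> = ?L h \<one>" by (simp only: gh(3))
    then show "g = h" using gh(1,2) by simp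
  qed
  ultimately have "?L \<in> iso G (Mon (cayley_hypermap G x y))"
    by (simp add: iso_def bij_betw_def carrier_Mon_cayley)
  then show ?thesis using iso_sym is_isoI by blast
qed

text \<open>The elements g whose left translation commutes with f form a subgroup containing x and
  y, hence all of G. Evaluating at the identity shows that f is a right translation.\<close>

lemma hypermap_aut_cayley:
  assumes f: "f \<in> hypermap_aut (cayley_hypermap G x y)" and u: "u \<in> carrier G"
  shows "f u = u \<otimes> f \<one>"
proof -
  have fB: "f \<in> carrier G \<rightarrow> carrier G"
    using f by (auto simp: hypermap_aut_def cayley_hypermap_def dest: Bij_imp_funcset)
  have comm: "f (x \<otimes> v) = x \<otimes> f v" "f (y \<otimes> v) = y \<otimes> f v" if "v \<in> carrier G" for v
    using f that fB by (auto simp: hypermap_aut_def cayley_hypermap_def)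
  let ?S = "{g \<in> carrier G. \<forall>v\<in>carrier G. f (g \<otimes> v) = g \<otimes> f v}"
  have "subgroup ?S G"
  proof (rule subgroupI)
    fix a assume a: "a \<in> ?S"
    have "f (inv a \<otimes> v) = inv a \<otimes> f v" if v: "v \<in> carrier G" for v
    proof -
      have aG: "a \<in> carrier G" using a by simp
      have "f (a \<otimes> (inv a \<otimes> v)) = a \<otimes> f (inv a \<otimes> v)" using a v by simp
      moreover have "a \<otimes> (inv a \<otimes> v) = v" using aG v by (simp add: m_assoc[symmetric])
      moreover have "f (inv a \<otimes> v) \<in> carrier G" "f v \<in> carrier G"
        using fB aG v by (simp_all add: Pi_iff)
      ultimately show ?thesis using aG inv_solve_left by simp
    qed
    then show "inv a \<in> ?S" using a by auto
  next
    fix a b assume "a \<in> ?S" "b \<in> ?S"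
    then show "a \<otimes> b \<in> ?S" using fB by (auto simp: m_assoc Pi_iff)
  next
    have "\<one> \<in> ?S" using fB by (simp add: Pi_iff)
    then show "?S \<noteq> {}" by blast
  qed auto
  moreover have "{x, y} \<subseteq> ?S" using xy comm by auto
  ultimately have "generate G {x, y} \<subseteq> ?S" by (intro generate_subgroup_incl)
  then have "carrier G \<subseteq> ?S" by (simp only: gen)
  then have "f (u \<otimes> \<one>) = u \<otimes> f \<one>" using u by blast
  then show ?thesis using u by simp
qed

lemma orientably_regular_cayley:
  assumes "finite (carrier G)"
  shows "orientably_regular (cayley_hypermap G x y)"
proof -
  let ?M = "cayley_hypermap G x y"
  have "is_hypermap ?M"
    unfolding is_hypermap_def carrier_Mon_cayley
  proof (intro conjI ballI)
    fix u v assume "u \<in> darts ?M" "v \<in> darts ?M"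
    then have uv: "u \<in> carrier G" "v \<in> carrier G" by (simp_all add: cayley_hypermap_def)
    show "\<exists>g\<in>(\<lambda>g. \<lambda>u\<in>carrier G. g \<otimes> u) ` carrier G. g u = v"
      by (rule bexI[of _ "\<lambda>w\<in>carrier G. (v \<otimes> inv u) \<otimes> w"]) (use uv in \<open>auto simp: m_assoc\<close>)
  qed (use assms xy left_mult_Bij in \<open>auto simp: cayley_hypermap_def\<close>)
  moreover have "\<exists>!f. f \<in> hypermap_aut ?M \<and> f u = v"
    if "u \<in> darts ?M" "v \<in> darts ?M" for u v
  proof -
    have uv: "u \<in> carrier G" "v \<in> carrier G" using that by (simp_all add: cayley_hypermap_def)
    let ?f = "\<lambda>w\<in>carrier G. w \<otimes> (inv u \<otimes> v)"
    have "?f \<in> hypermap_aut ?M"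
      using uv xy right_mult_Bij[of "inv u \<otimes> v"]
      by (auto simp: hypermap_aut_def cayley_hypermap_def m_assoc)
    moreover have "?f u = v" using uv by (simp add: m_assoc[symmetric])
    moreover have "f = ?f" if f: "f \<in> hypermap_aut ?M" "f u = v" for f
    proof
      fix w
      have fB: "f \<in> carrier G \<rightarrow> carrier G" and ext: "f \<in> extensional (carrier G)"
        using f by (auto simp: hypermap_aut_def cayley_hypermap_def
            dest: Bij_imp_funcset Bij_imp_extensional)
      then have c1: "f \<one> \<in> carrier G" by auto
      have "f \<one> = inv u \<otimes> v" 
        using hypermap_aut_cayley[OF f(1) uv(1)] f(2) uv c1 by (simp add: m_assoc[symmetric])
      then show "f w = ?f w"
        using hypermap_aut_cayley[OF f(1), of w] ext
        by (cases "w \<in> carrier G") (simp_all add: extensional_def)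
    qed
    ultimately show ?thesis by blast
  qed
  ultimately show ?thesis by (simp add: orientably_regular_def)
qed

lemma delta_hom_surj: "delta_hom G x y ` carrier Delta_plus = carrier G"
proof -
  interpret phi: group_hom Delta_plus G "delta_hom G x y"
    by (intro group_hom.intro group_hom_axioms.intro delta_hom_hom group_Delta_plus group_axioms xy)
  have "{x, y} \<subseteq> delta_hom G x y ` carrier Delta_plus"
    using imageI[OF rho_lam_Delta_plus(1), of "delta_hom G x y"]
      imageI[OF rho_lam_Delta_plus(2), of "delta_hom G x y"] by (simp add: delta_hom_gen[OF xy])
  then have "generate G {x, y} \<subseteq> delta_hom G x y ` carrier Delta_plus"
    by (rule generate_subgroup_incl[OF _ phi.img_is_subgroup])
  then have "carrier G \<subseteq> delta_hom G x y ` carrier Delta_plus" by (simp only: gen)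
  then show ?thesis using delta_hom_closed[OF xy] by auto
qed

text \<open>The cosets of the kernel are the fibres of \<open>delta_hom\<close>. Surjectivity makes
  them correspond bijectively to the elements of G, and left multiplication by \<open>rho\<close>
  and \<open>lam\<close> becomes that by x and y.\<close>

lemma is_hypermap_subgroup_cayley:
  assumes "finite (carrier G)"
  shows "is_hypermap_subgroup (cayley_hypermap G x y) (kernel Delta_plus G (delta_hom G x y))"
proof -
  let ?p = "delta_hom G x y" and ?D = Delta_plus
  let ?H = "kernel ?D G ?p"
  interpret D: group ?D by (rule group_Delta_plus)
  interpret phi: group_hom ?D G ?p
    by (intro group_hom.intro group_hom_axioms.intro delta_hom_hom group_Delta_plus group_axioms xy)
  define fib where "fib g = {z \<in> carrier ?D. ?p z = g}" for g
  have coset: "a <#\<^bsub>?D\<^esub> ?H = fib (?p a)" if a: "a \<in> carrier ?D" for a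
  proof (intro equalityI subsetI)
    fix z assume "z \<in> a <#\<^bsub>?D\<^esub> ?H"
    then obtain h where "h \<in> ?H" "z = a \<otimes>\<^bsub>?D\<^esub> h" by (auto simp: l_coset_def)
    then show "z \<in> fib (?p a)" using a xy by (auto simp: kernel_def fib_def delta_hom_closed)
  next
    fix z assume "z \<in> fib (?p a)"
    then have z: "z \<in> carrier ?D" "?p z = ?p a" by (auto simp: fib_def)
    then have "inv\<^bsub>?D\<^esub> a \<otimes>\<^bsub>?D\<^esub> z \<in> ?H" using a xy by (simp add: kernel_def delta_hom_closed)
    moreover have "z = a \<otimes>\<^bsub>?D\<^esub> (inv\<^bsub>?D\<^esub> a \<otimes>\<^bsub>?D\<^esub> z)"
      using a z by (simp add: D.m_assoc[symmetric])
    ultimately show "z \<in> a <#\<^bsub>?D\<^esub> ?H" by (auto simp: l_coset_def)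
  qed
  have cosets: "lcosets\<^bsub>?D\<^esub> ?H = fib ` carrier G"
  proof -
    have "lcosets\<^bsub>?D\<^esub> ?H = (\<lambda>a. a <#\<^bsub>?D\<^esub> ?H) ` carrier ?D" by (auto simp: LCOSETS_def)
    also have "\<dots> = (\<lambda>a. fib (?p a)) ` carrier ?D" by (rule image_cong[OF refl coset])
    also have "\<dots> = fib ` ?p ` carrier ?D" by (simp only: image_image)
    finally show ?thesis by (simp only: delta_hom_surj)
  qed
  have inj: "inj_on fib (carrier G)"
  proof (rule inj_onI)
    fix g h assume gh: "g \<in> carrier G" "h \<in> carrier G" "fib g = fib h"
    obtain z where "z \<in> carrier ?D" "?p z = g"
      using gh(1) unfolding delta_hom_surj[symmetric] by (elim imageE) simp
    then have "z \<in> fib g" by (simp add: fib_def)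
    then have "z \<in> fib h" using gh(3) by simp
    then show "g = h" using \<open>?p z = g\<close> by (simp add: fib_def)
  qed
  have act: "a <#\<^bsub>?D\<^esub> fib g = fib (?p a \<otimes> g)" if "a \<in> carrier ?D" "g \<in> carrier G" for a g
  proof -
    obtain b where b: "b \<in> carrier ?D" "g = ?p b"
      using \<open>g \<in> carrier G\<close> unfolding delta_hom_surj[symmetric] by (elim imageE) simp
    have "a <#\<^bsub>?D\<^esub> fib g = a <#\<^bsub>?D\<^esub> (b <#\<^bsub>?D\<^esub> ?H)" by (simp only: b coset)
    also have "\<dots> = (a \<otimes>\<^bsub>?D\<^esub> b) <#\<^bsub>?D\<^esub> ?H"
      by (rule D.lcos_m_assoc[OF subgroup.subset[OF phi.subgroup_kernel] that(1) b(1)])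
    also have "\<dots> = fib (?p (a \<otimes>\<^bsub>?D\<^esub> b))" by (rule coset) (use b that in simp)
    finally show ?thesis using b that by simp
  qed
  have "hypermap_iso (cayley_hypermap G x y) (coset_hypermap ?H)"
    unfolding hypermap_iso_def
  proof (intro exI conjI ballI)
    show "bij_betw fib (darts (cayley_hypermap G x y)) (darts (coset_hypermap ?H))"
      using inj by (simp add: bij_betw_def cayley_hypermap_def coset_hypermap_def cosets)
  next
    fix u assume "u \<in> darts (cayley_hypermap G x y)"
    then have u: "u \<in> carrier G" by (simp add: cayley_hypermap_def)
    show "fib (permR (cayley_hypermap G x y) u) = permR (coset_hypermap ?H) (fib u)"
      "fib (permL (cayley_hypermap G x y) u) = permL (coset_hypermap ?H) (fib u)"
      using u act[OF rho_lam_Delta_plus(1) u] act[OF rho_lam_Delta_plus(2) u] delta_hom_gen[OF xy]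
      by (simp_all add: cayley_hypermap_def coset_hypermap_def cosets)
  qed
  then show ?thesis
    using phi.normal_kernel assms by (simp add: is_hypermap_subgroup_def cosets)
qed

end

text \<open>For z in Delta^+ there is h in H whose value at the inverse pair is the value of z at
  (x, y). Then t = r2 h r2 lies in H^r and has the same image as z, so z t^-1 lies in H.\<close>

lemma totally_chiral_cayley:
  assumes "finite (carrier G)" "chiral_pair G x y"
  shows "totally_chiral (cayley_hypermap G x y)"
proof -
  have xy: "x \<in> carrier G" "y \<in> carrier G" and gen: "generate G {x, y} = carrier G"
    and c: "delta_hom G (inv x) (inv y) ` kernel Delta_plus G (delta_hom G x y) = carrier G"
    using assms(2) by (auto simp: chiral_pair_def)
  let ?p = "delta_hom G x y" and ?D = Delta_plus
  let ?H = "kernel ?D G ?p"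
  interpret D: group ?D by (rule group_Delta_plus)
  interpret phi: group_hom ?D G ?p
    by (intro group_hom.intro group_hom_axioms.intro delta_hom_hom group_Delta_plus group_axioms xy)
  have mult: "a \<otimes>\<^bsub>Delta\<^esub> b = delta_mult a b" "a \<otimes>\<^bsub>?D\<^esub> b = delta_mult a b" for a b
    by (simp_all add: Delta_plus_def Delta_def)
  have car: "z \<in> carrier ?D \<longleftrightarrow> delta_even z" for z by (simp add: Delta_plus_def)
  have conj: "conj_r2 ?H = (\<lambda>h. delta_mult (delta_mult r2 h) r2) ` ?H"
    by (auto simp: conj_r2_def r_coset_def l_coset_def mult)
  have conj_even: "delta_even (delta_mult (delta_mult r2 h) r2) \<longleftrightarrow> delta_even h" for h
    by (auto simp: delta_even_mult)
  have "?H <#>\<^bsub>Delta\<^esub> conj_r2 ?H = carrier ?D"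
  proof (intro equalityI subsetI)
    fix z assume "z \<in> ?H <#>\<^bsub>Delta\<^esub> conj_r2 ?H"
    then obtain a b where "a \<in> ?H" "b \<in> ?H"
      "z = delta_mult a (delta_mult (delta_mult r2 b) r2)"
      by (auto simp: conj set_mult_def mult)
    then show "z \<in> carrier ?D" by (simp add: kernel_def car conj_even delta_even_mult)
  next
    fix z assume z: "z \<in> carrier ?D"
    then have "?p z \<in> carrier G" by simp
    then obtain h where h: "h \<in> ?H" "?p z = delta_hom G (inv x) (inv y) h" using c by (metis imageE)
    define t where "t = delta_mult (delta_mult r2 h) r2"
    have "t \<in> conj_r2 ?H" unfolding conj t_def using h(1) by (rule imageI)
    moreover have "delta_even h" using h(1) by (simp add: kernel_def car)
    ultimately have t: "t \<in> carrier ?D" "t \<in> conj_r2 ?H" "?p t = ?p z"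
      using h(2) xy by (simp_all add: t_def car conj_even delta_hom_conj_r2)
    have "z \<otimes>\<^bsub>?D\<^esub> inv\<^bsub>?D\<^esub> t \<in> ?H" using z t by (simp add: kernel_def)
    moreover have "z = delta_mult (z \<otimes>\<^bsub>?D\<^esub> inv\<^bsub>?D\<^esub> t) t"
      using z t by (simp add: mult(2)[symmetric] D.m_assoc)
    ultimately show "z \<in> ?H <#>\<^bsub>Delta\<^esub> conj_r2 ?H"
      using t(2) unfolding set_mult_def mult by blast
  qed
  then show ?thesis
    using is_hypermap_subgroup_cayley[OF xy gen assms(1)]
      orientably_regular_cayley[OF xy gen assms(1)]
    unfolding totally_chiral_def by blast
qed

text \<open>The darts have to be natural numbers, so the multiplication of G is copied to
  \<open>nat\<close> along an injection and the pair is carried over by the resulting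
  isomorphism.\<close>

theorem chiral_pair_imp_totally_chiral:
  assumes fin: "finite (carrier G)" and c: "chiral_pair G x y"
  shows "\<exists>M :: nat hypermap. totally_chiral M \<and> Mon M \<cong> G"
proof -
  obtain e :: "'a \<Rightarrow> nat" where e: "inj_on e (carrier G)"
    using finite_imp_inj_to_nat_seg[OF fin] by blast
  define K :: "nat monoid" where "K = \<lparr>carrier = e ` carrier G,
    monoid.mult = (\<lambda>a b. e (inv_into (carrier G) e a \<otimes> inv_into (carrier G) e b)), one = e \<one>\<rparr>"
  have hom: "e \<in> hom G K" by (rule homI) (use e in \<open>auto simp: K_def\<close>)
  then have "group (K\<lparr>carrier := e ` carrier G, one := e \<one>\<rparr>)" by (rule hom_imp_img_group)
  then have K: "group K" by (simp add: K_def)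
  have gh: "group_hom G K e"
    by (rule group_hom.intro[OF group_axioms K group_hom_axioms.intro[OF hom]])
  have "carrier K = e ` carrier G" by (simp add: K_def)
  then have "e \<in> iso G K" using hom e by (simp add: iso_def bij_betw_def)
  then have "K \<cong> G" using iso_sym is_isoI by blast
  have cK: "chiral_pair K (e x) (e y)"
    by (rule chiral_pair_image[OF gh _ c]) (simp add: K_def)
  have fK: "finite (carrier K)" using fin by (simp add: K_def)
  have "Mon (cayley_hypermap K (e x) (e y)) \<cong> K"
    by (rule group.Mon_cayley_iso[OF K]) (use cK in \<open>simp_all add: chiral_pair_def\<close>)
  then have "Mon (cayley_hypermap K (e x) (e y)) \<cong> G" using \<open>K \<cong> G\<close> by (rule iso_trans)
  then show ?thesis using group.totally_chiral_cayley[OF K fK cK] by (intro exI conjI)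
qed

end

section \<open>Matrices over a ring given by its carrier\<close>

lemma (in abelian_monoid) finsum_swap:
  assumes "finite A" "finite B" "\<And>i j. i \<in> A \<Longrightarrow> j \<in> B \<Longrightarrow> f i j \<in> carrier G"
  shows "(\<Oplus>i\<in>A. \<Oplus>j\<in>B. f i j) = (\<Oplus>j\<in>B. \<Oplus>i\<in>A. f i j)"
  using assms(1,3)
proof (induction A rule: finite_induct)
  case empty
  then show ?case using assms(2) by simp
next
  case (insert x A)
  have "(\<Oplus>j\<in>B. \<Oplus>i\<in>insert x A. f i j) = (\<Oplus>j\<in>B. f x j \<oplus> (\<Oplus>i\<in>A. f i j))"
    by (rule finsum_cong') (use insert in \<open>auto simp: Pi_iff\<close>)
  also have "\<dots> = (\<Oplus>j\<in>B. f x j) \<oplus> (\<Oplus>j\<in>B. \<Oplus>i\<in>A. f i j)"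
    by (rule finsum_addf) (use insert in auto)
  finally show ?case using insert by (simp add: Pi_iff)
qed

lemma (in abelian_monoid) finsum_delta:
  assumes "finite A" "i \<in> A" "f i \<in> carrier G"
  shows "(\<Oplus>k\<in>A. if k = i then f k else \<zero>) = f i"
proof -
  have "(\<Oplus>k\<in>A. if k = i then f k else \<zero>) = (\<Oplus>k\<in>A. if i = k then f i else \<zero>)"
    by (rule finsum_cong') (use assms in auto)
  also have "\<dots> = f i"
    using finsum_singleton[of i A "\<lambda>_. f i"] assms by simp
  finally show ?thesis .
qed

lemma mat_overD:
  "A \<in> mat_over F d \<Longrightarrow> i < d \<Longrightarrow> j < d \<Longrightarrow> A $$ (i, j) \<in> carrier F"
  by (simp add: mat_over_def)

lemma mat_over_dim:
  "A \<in> mat_over F d \<Longrightarrow> dim_row A = d" "A \<in> mat_over F d \<Longrightarrow> dim_col A = d"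
  by (auto simp: mat_over_def)

lemma mat_over_eqI:
  assumes "A \<in> mat_over F d" "B \<in> mat_over F d"
    "\<And>i j. i < d \<Longrightarrow> j < d \<Longrightarrow> A $$ (i, j) = B $$ (i, j)"
  shows "A = B"
  using assms by (intro eq_matI) (auto simp: mat_over_dim)

lemma mat_in_mat_over:
  "(\<And>i j. i < d \<Longrightarrow> j < d \<Longrightarrow> f (i, j) \<in> carrier F) \<Longrightarrow> mat d d f \<in> mat_over F d"
  by (simp add: mat_over_def)

lemma mult_over_index:
  "i < d \<Longrightarrow> j < d \<Longrightarrow>
    mult_over F d A B $$ (i, j) = (\<Oplus>\<^bsub>F\<^esub>k\<in>{..<d}. A $$ (i, k) \<otimes>\<^bsub>F\<^esub> B $$ (k, j))"
  by (simp add: mult_over_def)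

lemma one_over_index:
  "i < d \<Longrightarrow> j < d \<Longrightarrow> one_over F d $$ (i, j) = (if i = j then \<one>\<^bsub>F\<^esub> else \<zero>\<^bsub>F\<^esub>)"
  by (simp add: one_over_def)

lemma finite_mat_over:
  assumes "finite (carrier F)"
  shows "finite (mat_over F d)"
proof -
  have "mat_over F d \<subseteq> mat d d ` (({..<d} \<times> {..<d}) \<rightarrow>\<^sub>E carrier F)"
  proof
    fix A assume A: "A \<in> mat_over F d"
    have "A = mat d d (restrict (\<lambda>p. A $$ p) ({..<d} \<times> {..<d}))"
      using A by (intro eq_matI) (auto simp: mat_over_dim)
    moreover have "restrict (\<lambda>p. A $$ p) ({..<d} \<times> {..<d}) \<in> ({..<d} \<times> {..<d}) \<rightarrow>\<^sub>E carrier F"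
      using A by (auto simp: mat_overD)
    ultimately show "A \<in> mat d d ` (({..<d} \<times> {..<d}) \<rightarrow>\<^sub>E carrier F)" by blast
  qed
  moreover have "finite (({..<d} \<times> {..<d}) \<rightarrow>\<^sub>E carrier F)"
    by (rule finite_PiE) (use assms in auto)
  ultimately show ?thesis by (rule finite_subset[OF _ finite_imageI])
qed

section \<open>Elementary and monomial matrices\<close>

definition elementary :: "('a, 'm) ring_scheme \<Rightarrow> nat \<Rightarrow> nat \<Rightarrow> nat \<Rightarrow> 'a \<Rightarrow> 'a mat" where
  "elementary F d i j s = mat d d
     (\<lambda>(r, c). if r = i \<and> c = j then s else if r = c then \<one>\<^bsub>F\<^esub> else \<zero>\<^bsub>F\<^esub>)"

text \<open>The columns carry the indices: basis vector c goes to f c times basis vector p c.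
  Diagonal matrices are the case p = \<open>id\<close>.\<close>

definition monomial :: "('a, 'm) ring_scheme \<Rightarrow> nat \<Rightarrow> (nat \<Rightarrow> nat) \<Rightarrow> (nat \<Rightarrow> 'a) \<Rightarrow> 'a mat" where
  "monomial F d p f = mat d d (\<lambda>(r, c). if r = p c then f c else \<zero>\<^bsub>F\<^esub>)"

lemma elementary_index:
  "r < d \<Longrightarrow> c < d \<Longrightarrow> elementary F d i j s $$ (r, c) =
    (if r = i \<and> c = j then s else if r = c then \<one>\<^bsub>F\<^esub> else \<zero>\<^bsub>F\<^esub>)"
  by (simp add: elementary_def)

lemma monomial_index:
  "r < d \<Longrightarrow> c < d \<Longrightarrow> monomial F d p f $$ (r, c) = (if r = p c then f c else \<zero>\<^bsub>F\<^esub>)"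
  by (simp add: monomial_def)

context cring
begin

lemma mult_over_closed:
  "A \<in> mat_over R d \<Longrightarrow> B \<in> mat_over R d \<Longrightarrow> mult_over R d A B \<in> mat_over R d"
  unfolding mult_over_def by (rule mat_in_mat_over) (auto intro!: finsum_closed simp: mat_overD)

lemma one_over_closed: "one_over R d \<in> mat_over R d"
  unfolding one_over_def by (rule mat_in_mat_over) auto

lemma mult_over_assoc:
  assumes A: "A \<in> mat_over R d" and B: "B \<in> mat_over R d" and C: "C \<in> mat_over R d"
  shows "mult_over R d (mult_over R d A B) C = mult_over R d A (mult_over R d B C)"
proof (rule mat_over_eqI)
  fix i j assume ij: "i < d" "j < d"
  have "mult_over R d (mult_over R d A B) C $$ (i, j) =
      (\<Oplus>k\<in>{..<d}. (\<Oplus>l\<in>{..<d}. A $$ (i, l) \<otimes> B $$ (l, k)) \<otimes> C $$ (k, j))"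
    using ij by (auto simp: mult_over_index mat_overD[OF A] mat_overD[OF B] mat_overD[OF C]
        intro!: finsum_cong')
  also have "\<dots> = (\<Oplus>k\<in>{..<d}. \<Oplus>l\<in>{..<d}. A $$ (i, l) \<otimes> B $$ (l, k) \<otimes> C $$ (k, j))"
    using ij by (intro finsum_cong' refl finsum_ldistr)
      (auto simp: mat_overD[OF A] mat_overD[OF B] mat_overD[OF C])
  also have "\<dots> = (\<Oplus>l\<in>{..<d}. \<Oplus>k\<in>{..<d}. A $$ (i, l) \<otimes> B $$ (l, k) \<otimes> C $$ (k, j))"
    using ij by (intro finsum_swap)
      (auto simp: mat_overD[OF A] mat_overD[OF B] mat_overD[OF C])
  also have "\<dots> = (\<Oplus>l\<in>{..<d}. A $$ (i, l) \<otimes> (\<Oplus>k\<in>{..<d}. B $$ (l, k) \<otimes> C $$ (k, j)))"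
  proof (intro finsum_cong' refl)
    fix l assume "l \<in> {..<d}"
    then show "(\<Oplus>k\<in>{..<d}. A $$ (i, l) \<otimes> B $$ (l, k) \<otimes> C $$ (k, j)) =
        A $$ (i, l) \<otimes> (\<Oplus>k\<in>{..<d}. B $$ (l, k) \<otimes> C $$ (k, j))"
      using ij by (subst finsum_rdistr)
        (auto simp: mat_overD[OF A] mat_overD[OF B] mat_overD[OF C] m_assoc intro!: finsum_cong')
  qed (use ij in \<open>auto simp: mat_overD[OF A] mat_overD[OF B] mat_overD[OF C]\<close>)
  also have "\<dots> = mult_over R d A (mult_over R d B C) $$ (i, j)"
    using ij by (auto simp: mult_over_index mat_overD[OF A] mat_overD[OF B] mat_overD[OF C]
        intro!: finsum_cong')
  finally show "mult_over R d (mult_over R d A B) C $$ (i, j) =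
      mult_over R d A (mult_over R d B C) $$ (i, j)" .
qed (use A B C in \<open>auto intro!: mult_over_closed\<close>)

lemma monomial_closed:
  "(\<And>c. c < d \<Longrightarrow> f c \<in> carrier R) \<Longrightarrow> monomial R d p f \<in> mat_over R d"
  unfolding monomial_def by (rule mat_in_mat_over) auto

text \<open>Injectivity of p leaves a single term in row p r. Indexing the row as p r keeps inverse
  permutations out of the formula.\<close>

lemma mult_monomial_left:
  assumes p: "p permutes {..<d}" and f: "\<And>c. c < d \<Longrightarrow> f c \<in> carrier R"
    and A: "A \<in> mat_over R d" and rc: "r < d" "c < d"
  shows "mult_over R d (monomial R d p f) A $$ (p r, c) = f r \<otimes> A $$ (r, c)"
proof -
  have pr: "p r < d" using p rc(1) permutes_in_image by fastforce
  have "mult_over R d (monomial R d p f) A $$ (p r, c) =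
      (\<Oplus>k\<in>{..<d}. if k = r then f k \<otimes> A $$ (k, c) else \<zero>)"
    unfolding mult_over_index[OF pr rc(2)]
    using pr rc f permutes_inj[OF p]
    by (intro finsum_cong') (auto simp: monomial_def mat_overD[OF A] inj_eq)
  also have "\<dots> = f r \<otimes> A $$ (r, c)"
    by (rule finsum_delta) (use rc f in \<open>auto simp: mat_overD[OF A]\<close>)
  finally show ?thesis .
qed

lemma mult_elementary_left:
  assumes s: "s \<in> carrier R" and A: "A \<in> mat_over R d" and ij: "i \<noteq> j" "j < d" and rc: "r < d" "c < d"
  shows "mult_over R d (elementary R d i j s) A $$ (r, c) =
    (if r = i then A $$ (r, c) \<oplus> s \<otimes> A $$ (j, c) else A $$ (r, c))"
proof -
  \<comment> \<open>Row r of the left factor is split into the unit row r and, for r = i, the entry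
    s in column j; each part leaves one summand.\<close>
  have "mult_over R d (elementary R d i j s) A $$ (r, c) =
      (\<Oplus>k\<in>{..<d}. (if k = r then A $$ (k, c) else \<zero>) \<oplus>
        (if k = j then (if r = i then s \<otimes> A $$ (k, c) else \<zero>) else \<zero>))"
    unfolding mult_over_index[OF rc]
    using s ij rc by (intro finsum_cong') (auto simp: elementary_def mat_overD[OF A])
  also have "\<dots> = (\<Oplus>k\<in>{..<d}. if k = r then A $$ (k, c) else \<zero>) \<oplus>
      (\<Oplus>k\<in>{..<d}. if k = j then (if r = i then s \<otimes> A $$ (k, c) else \<zero>) else \<zero>)"
    using s rc by (intro finsum_addf) (auto simp: mat_overD[OF A])
  also have "\<dots> = A $$ (r, c) \<oplus> (if r = i then s \<otimes> A $$ (j, c) else \<zero>)"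
    using s rc ij by (subst (1 2) finsum_delta) (auto simp: mat_overD[OF A])
  finally show ?thesis using s rc ij by (auto simp: mat_overD[OF A])
qed

lemma elementary_closed: "s \<in> carrier R \<Longrightarrow> elementary R d i j s \<in> mat_over R d"
  unfolding elementary_def by (rule mat_in_mat_over) auto

lemma one_over_monomial: "one_over R d = monomial R d id (\<lambda>_. \<one>)"
  by (rule eq_matI) (auto simp: one_over_def monomial_def)

lemma one_over_mult:
  assumes "A \<in> mat_over R d"
  shows "mult_over R d (one_over R d) A = A"
  using mult_monomial_left[of id d "\<lambda>_. \<one>" A] assms permutes_id[of "{..<d}"]
  by (intro mat_over_eqI[of _ R d])
    (auto simp: mult_over_closed one_over_closed mat_overD one_over_monomial[symmetric])

lemma elementary_mult_one:
  assumes "s \<in> carrier R" "i \<noteq> j" "i < d" "j < d"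
  shows "mult_over R d (elementary R d i j s) (one_over R d) = elementary R d i j s"
  using assms
  by (intro mat_over_eqI[of _ R d])
    (auto simp: mult_over_closed one_over_closed elementary_closed mult_elementary_left
      one_over_index elementary_index)

lemma elementary_add:
  assumes "s \<in> carrier R" "t \<in> carrier R" "i \<noteq> j" "i < d" "j < d"
  shows "mult_over R d (elementary R d i j s) (elementary R d i j t) = elementary R d i j (s \<oplus> t)"
proof (rule mat_over_eqI[of _ R d])
  fix r c assume "r < d" "c < d"
  then show "mult_over R d (elementary R d i j s) (elementary R d i j t) $$ (r, c) =
      elementary R d i j (s \<oplus> t) $$ (r, c)"
    unfolding mult_elementary_left[OF assms(1) elementary_closed[OF assms(2)] assms(3,5) \<open>r < d\<close> \<open>c < d\<close>]
    using assms by (auto simp: elementary_def a_comm)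
qed (use assms in \<open>auto simp: mult_over_closed elementary_closed\<close>)

lemma elementary_zero: "i \<noteq> j \<Longrightarrow> elementary R d i j \<zero> = one_over R d"
  by (rule eq_matI) (auto simp: elementary_def one_over_def)

text \<open>The relation [E_ij(s), E_jk(t)] = E_ik(s t), with the inverses moved to the other side
  because no group structure is available at this stage.\<close>

lemma elementary_commutator:
  assumes st: "s \<in> carrier R" "t \<in> carrier R" and ijk: "i < d" "j < d" "k < d" "i \<noteq> j" "j \<noteq> k" "i \<noteq> k"
  shows "mult_over R d (elementary R d i j s) (elementary R d j k t) =
    mult_over R d (elementary R d i k (s \<otimes> t))
      (mult_over R d (elementary R d j k t) (elementary R d i j s))"
proof (rule mat_over_eqI[of _ R d])
  fix r c assume rc: "r < d" "c < d"
  show "mult_over R d (elementary R d i j s) (elementary R d j k t) $$ (r, c) =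
    mult_over R d (elementary R d i k (s \<otimes> t))
      (mult_over R d (elementary R d j k t) (elementary R d i j s)) $$ (r, c)"
    using st ijk rc
    by (simp add: mult_elementary_left mult_over_closed elementary_closed elementary_index)
qed (use st in \<open>auto simp: mult_over_closed elementary_closed\<close>)

text \<open>Conjugation by a monomial matrix permutes the root positions and rescales the parameter
  by f i / f j; the condition on t expresses this without division.\<close>

lemma monomial_elementary:
  assumes p: "p permutes {..<d}" and f: "\<And>c. c < d \<Longrightarrow> f c \<in> carrier R"
    and st: "s \<in> carrier R" "t \<in> carrier R" "t \<otimes> f j = f i \<otimes> s" and ij: "i < d" "j < d" "i \<noteq> j"
  shows "mult_over R d (monomial R d p f) (elementary R d i j s) =
    mult_over R d (elementary R d (p i) (p j) t) (monomial R d p f)"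
proof (rule mat_over_eqI[of _ R d])
  fix r' c assume rc': "r' < d" "c < d"
  define r where "r = inv_into UNIV p r'"
  have r: "r' = p r" "r < d"
    using rc' permutes_inverses(1)[OF p] permutes_in_image[OF permutes_inv[OF p], of r']
    by (auto simp: r_def)
  have lt: "p x < d" if "x < d" for x using permutes_in_image[OF p, of x] that by simp
  have inj: "p x = p y \<longleftrightarrow> x = y" for x y using permutes_inj[OF p] by (simp add: inj_eq)
  have m: "monomial R d p f $$ (p x, c) = (if x = c then f c else \<zero>)" if "x < d" for x
    using that rc' lt inj by (simp add: monomial_index)
  have fc: "f c \<in> carrier R" "f i \<in> carrier R" "f j \<in> carrier R" using f ij rc' by auto
  show "mult_over R d (monomial R d p f) (elementary R d i j s) $$ (r', c) =
    mult_over R d (elementary R d (p i) (p j) t) (monomial R d p f) $$ (r', c)"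
  proof -
    have L: "mult_over R d (monomial R d p f) (elementary R d i j s) $$ (p r, c) =
        f r \<otimes> elementary R d i j s $$ (r, c)"
      by (rule mult_monomial_left) (use p f st r rc' in \<open>auto intro!: elementary_closed\<close>)
    have "mult_over R d (elementary R d (p i) (p j) t) (monomial R d p f) $$ (p r, c) =
        (if r = i then (if r = c then f c else \<zero>) \<oplus> t \<otimes> (if j = c then f c else \<zero>)
         else if r = c then f c else \<zero>)"
      using f st(2) ij rc' r lt
      by (subst mult_elementary_left) (auto intro!: monomial_closed simp: inj m)
    also have "\<dots> = f r \<otimes> elementary R d i j s $$ (r, c)"
    proof (cases "r = i \<and> c = j")
      case True
      then show ?thesis using ij st fc rc' r by (simp add: elementary_index)
    next
      case False
      then show ?thesis using ij st fc rc' r f[OF r(2)] by (auto simp: elementary_index)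
    qed
    finally have "mult_over R d (elementary R d (p i) (p j) t) (monomial R d p f) $$ (p r, c) =
        f r \<otimes> elementary R d i j s $$ (r, c)" .
    with L show ?thesis by (simp only: r(1))
  qed
qed (use f st in \<open>auto simp: mult_over_closed elementary_closed monomial_closed\<close>)

lemma monomial_mult:
  assumes p: "p permutes {..<d}" and q: "q permutes {..<d}"
    and f: "\<And>c. c < d \<Longrightarrow> f c \<in> carrier R" and g: "\<And>c. c < d \<Longrightarrow> g c \<in> carrier R"
  shows "mult_over R d (monomial R d p f) (monomial R d q g) =
    monomial R d (p \<circ> q) (\<lambda>c. f (q c) \<otimes> g c)"
proof (rule mat_over_eqI[of _ R d])
  fix r' c assume rc': "r' < d" "c < d"
  define r where "r = inv_into UNIV p r'"
  have r: "r' = p r" "r < d"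
    using rc' permutes_inverses(1)[OF p] permutes_in_image[OF permutes_inv[OF p], of r']
    by (auto simp: r_def)
  have inj: "p x = p y \<longleftrightarrow> x = y" for x y using permutes_inj[OF p] by (simp add: inj_eq)
  show "mult_over R d (monomial R d p f) (monomial R d q g) $$ (r', c) =
      monomial R d (p \<circ> q) (\<lambda>c. f (q c) \<otimes> g c) $$ (r', c)"
  proof -
    have "mult_over R d (monomial R d p f) (monomial R d q g) $$ (p r, c) =
        f r \<otimes> monomial R d q g $$ (r, c)"
      by (rule mult_monomial_left) (use p f g r rc' in \<open>auto intro!: monomial_closed\<close>)
    then show ?thesis using rc' r f[OF r(2)] by (auto simp: monomial_index inj)
  qed
next
  have "q c < d" if "c < d" for c using permutes_in_image[OF q, of c] that by simp
  then show "monomial R d (p \<circ> q) (\<lambda>c. f (q c) \<otimes> g c) \<in> mat_over R d"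
    using f g by (intro monomial_closed) auto
qed (use f g in \<open>auto simp: mult_over_closed monomial_closed\<close>)

end

section \<open>Determinants and row reduction\<close>

definition sign_over :: "('a, 'm) ring_scheme \<Rightarrow> (nat \<Rightarrow> nat) \<Rightarrow> 'a" where
  "sign_over F p = (if evenperm p then \<one>\<^bsub>F\<^esub> else \<ominus>\<^bsub>F\<^esub> \<one>\<^bsub>F\<^esub>)"

lemma det_over_sign:
  "det_over F d A = (\<Oplus>\<^bsub>F\<^esub>p\<in>{p. p permutes {..<d}}.
     sign_over F p \<otimes>\<^bsub>F\<^esub> (\<Otimes>\<^bsub>F\<^esub>i\<in>{..<d}. A $$ (i, p i)))"
  by (simp add: det_over_def sign_over_def)

context cring
begin

lemma sign_over_closed: "sign_over R p \<in> carrier R"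
  by (simp add: sign_over_def)

lemma sign_over_square: "sign_over R p \<otimes> sign_over R p = \<one>"
  by (simp add: sign_over_def l_minus)

lemma finprod_zero_factor:
  assumes "finite A" "i \<in> A" "f i = \<zero>" "f \<in> A \<rightarrow> carrier R"
  shows "finprod R f A = \<zero>"
proof -
  have "finprod R f (insert i (A - {i})) = f i \<otimes> finprod R f (A - {i})"
    by (rule finprod_insert) (use assms in auto)
  then show ?thesis using assms by (simp add: insert_absorb finprod_closed Pi_iff)
qed

lemma perm_lt: "p permutes {..<d} \<Longrightarrow> i < d \<Longrightarrow> p i < (d :: nat)"
  using permutes_in_image[of p "{..<d}" i] by simp

lemma det_over_eq_zero:
  assumes A: "A \<in> mat_over R d"
    and z: "\<And>p. p permutes {..<d} \<Longrightarrow> \<exists>i<d. A $$ (i, p i) = \<zero>"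
  shows "det_over R d A = \<zero>"
  unfolding det_over_sign
proof (intro add.finprod_one_eqI)
  fix p assume "p \<in> {p. p permutes {..<d}}"
  then have p: "p permutes {..<d}" by simp
  obtain i where "i < d" "A $$ (i, p i) = \<zero>" using z[OF p] by blast
  then have "(\<Otimes>i\<in>{..<d}. A $$ (i, p i)) = \<zero>"
    by (intro finprod_zero_factor[of _ i]) (auto simp: mat_overD[OF A] perm_lt[OF p])
  then show "sign_over R p \<otimes> (\<Otimes>i\<in>{..<d}. A $$ (i, p i)) = \<zero>" by (simp add: sign_over_closed)
qed

lemma det_over_single:
  assumes A: "A \<in> mat_over R d" and q: "q permutes {..<d}"
    and z: "\<And>p. p permutes {..<d} \<Longrightarrow> p \<noteq> q \<Longrightarrow> \<exists>i<d. A $$ (i, p i) = \<zero>"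
  shows "det_over R d A = sign_over R q \<otimes> (\<Otimes>i\<in>{..<d}. A $$ (i, q i))"
proof -
  let ?t = "\<lambda>p. sign_over R p \<otimes> (\<Otimes>i\<in>{..<d}. A $$ (i, p i))"
  have closed: "?t p \<in> carrier R" if "p permutes {..<d}" for p
    using that by (auto simp: sign_over_closed mat_overD[OF A] perm_lt intro!: finprod_closed)
  have zero: "?t p = \<zero>" if p: "p permutes {..<d}" "p \<noteq> q" for p
  proof -
    obtain i where "i < d" "A $$ (i, p i) = \<zero>" using z[OF p] by blast
    then have "(\<Otimes>i\<in>{..<d}. A $$ (i, p i)) = \<zero>"
      by (intro finprod_zero_factor[of _ i]) (auto simp: mat_overD[OF A] perm_lt[OF p(1)])
    then show ?thesis by (simp add: sign_over_closed)
  qed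
  have "det_over R d A = (\<Oplus>p\<in>{p. p permutes {..<d}}. if p = q then ?t p else \<zero>)"
    unfolding det_over_sign using closed zero by (intro finsum_cong') auto
  also have "\<dots> = ?t q"
    by (rule finsum_delta) (use q closed in \<open>auto simp: finite_permutations\<close>)
  finally show ?thesis .
qed

text \<open>Row i has its entry in column p^-1 i, so the surviving term of the expansion belongs to
  p^-1, whose sign is that of p.\<close>

lemma det_over_monomial:
  assumes p: "p permutes {..<d}" and f: "\<And>c. c < d \<Longrightarrow> f c \<in> carrier R"
  shows "det_over R d (monomial R d p f) = sign_over R p \<otimes> (\<Otimes>c\<in>{..<d}. f c)"
proof -
  let ?q = "inv_into UNIV p"
  have q: "?q permutes {..<d}" by (rule permutes_inv[OF p])
  have pq: "p (?q i) = i" "?q (p i) = i" for i using permutes_inverses[OF p] by auto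
  have "det_over R d (monomial R d p f) =
      sign_over R ?q \<otimes> (\<Otimes>i\<in>{..<d}. monomial R d p f $$ (i, ?q i))"
  proof (rule det_over_single[OF monomial_closed[OF f] q])
    fix q' assume q': "q' permutes {..<d}" "q' \<noteq> ?q"
    then obtain i where i: "q' i \<noteq> ?q i" by blast
    then have "i < d" using permutes_not_in[OF q'(1), of i] permutes_not_in[OF q, of i]
      by (cases "i < d") simp_all
    moreover have "p (q' i) \<noteq> i" using i pq by metis
    ultimately show "\<exists>i<d. monomial R d p f $$ (i, q' i) = \<zero>"
      using perm_lt[OF q'(1)] by (auto simp: monomial_index intro!: exI[of _ i])
  qed simp
  also have "(\<Otimes>i\<in>{..<d}. monomial R d p f $$ (i, ?q i)) = (\<Otimes>i\<in>{..<d}. f (?q i))"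
    using f perm_lt[OF q] pq by (intro finprod_cong') (auto simp: monomial_index)
  also have "\<dots> = (\<Otimes>c\<in>?q ` {..<d}. f c)"
    using f perm_lt[OF q] permutes_inj_on[OF q] by (subst finprod_reindex) auto
  also have "?q ` {..<d} = {..<d}" by (rule permutes_image[OF q])
  also have "sign_over R ?q = sign_over R p"
    using p by (simp add: sign_over_def evenperm_inv permutes_imp_permutation[OF finite_lessThan])
  finally show ?thesis .
qed

lemma det_over_one: "det_over R d (one_over R d) = \<one>"
  unfolding one_over_monomial by (subst det_over_monomial) (auto simp: permutes_id sign_over_def)

text \<open>Multiplying a permutation by the transposition of the two equal rows pairs even with
  odd permutations, so the terms of the determinant cancel in every characteristic.\<close>

lemma alternating_sum_zero:
  assumes ij: "i < d" "j < d" "i \<noteq> j"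
    and u: "\<And>p. p permutes {..<d} \<Longrightarrow> u p \<in> carrier R"
    and inv: "\<And>p. p permutes {..<d} \<Longrightarrow> u (p \<circ> transpose i j) = u p"
  shows "(\<Oplus>p\<in>{p. p permutes {..<d}}. sign_over R p \<otimes> u p) = \<zero>"
proof -
  let ?e = "{p. p permutes {..<d} \<and> evenperm p}" and ?o = "{p. p permutes {..<d} \<and> \<not> evenperm p}"
  let ?h = "\<lambda>p. p \<circ> transpose i j"
  have fin: "finite ?e" "finite ?o"
    by (rule finite_subset[OF _ finite_permutations[of "{..<d}"]]; auto)+
  have tr: "transpose i j permutes {..<d}" using ij by (intro permutes_swap_id) auto
  have perm: "?h p permutes {..<d}" if "p permutes {..<d}" for p
    using permutes_compose[OF tr that] .
  have ev: "evenperm (?h p) \<longleftrightarrow> \<not> evenperm p" if "p permutes {..<d}" for p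
    using evenperm_comp[OF permutes_imp_permutation[OF finite_lessThan that]
        permutes_imp_permutation[OF finite_lessThan tr]] ij by (simp add: evenperm_swap)
  have hh: "?h (?h p) = p" for p by (simp add: fun_eq_iff)
  have img: "?h ` ?e = ?o"
  proof (intro equalityI subsetI)
    fix p assume "p \<in> ?o"
    then have "?h p \<in> ?e" using perm ev by auto
    then show "p \<in> ?h ` ?e" by (rule rev_image_eqI) (simp add: hh)
  qed (use perm ev in auto)
  have inj: "inj_on ?h ?e" by (rule inj_on_inverseI[of _ ?h]) (rule hh)
  have "(\<Oplus>p\<in>{p. p permutes {..<d}}. sign_over R p \<otimes> u p) =
      (\<Oplus>p\<in>?e \<union> ?o. sign_over R p \<otimes> u p)"
    by (rule arg_cong[of _ _ "finsum R _"]) auto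
  also have "\<dots> = (\<Oplus>p\<in>?e. sign_over R p \<otimes> u p) \<oplus> (\<Oplus>p\<in>?o. sign_over R p \<otimes> u p)"
    using u fin by (intro finsum_Un_disjoint) (auto simp: sign_over_closed)
  also have "(\<Oplus>p\<in>?o. sign_over R p \<otimes> u p) = (\<Oplus>p\<in>?e. sign_over R (?h p) \<otimes> u (?h p))"
    unfolding img[symmetric] using inj u perm
    by (intro finsum_reindex) (auto simp: sign_over_closed)
  also have "\<dots> = (\<Oplus>p\<in>?e. \<ominus> u p)"
    using u perm ev inv by (intro finsum_cong') (auto simp: sign_over_def l_minus)
  also have "(\<Oplus>p\<in>?e. sign_over R p \<otimes> u p) = (\<Oplus>p\<in>?e. u p)"
    using u by (intro finsum_cong') (auto simp: sign_over_def)
  also have "(\<Oplus>p\<in>?e. u p) \<oplus> (\<Oplus>p\<in>?e. \<ominus> u p) = (\<Oplus>p\<in>?e. u p \<oplus> \<ominus> u p)"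
    using u by (intro finsum_addf[symmetric]) auto
  also have "\<dots> = \<zero>" using u by (intro add.finprod_one_eqI) (auto simp: r_neg)
  finally show ?thesis .
qed

text \<open>The expansion is linear in row i. The extra part is s times the determinant of A with
  row i replaced by row j, which vanishes because two rows agree.\<close>

lemma det_over_elementary_mult:
  assumes s: "s \<in> carrier R" and A: "A \<in> mat_over R d" and ij: "i < d" "j < d" "i \<noteq> j"
  shows "det_over R d (mult_over R d (elementary R d i j s) A) = det_over R d A"
proof -
  let ?B = "mult_over R d (elementary R d i j s) A"
  define rest where "rest p = (\<Otimes>r\<in>{..<d} - {i}. A $$ (r, p r))" for p
  \<comment> \<open>Leibniz product of the matrix whose row i has been replaced by row j.\<close>
  define u where "u p = A $$ (j, p i) \<otimes> rest p" for p
  note aD = mat_overD[OF A]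
  have rest: "rest p \<in> carrier R" if "p permutes {..<d}" for p
    unfolding rest_def using that by (intro finprod_closed) (auto simp: aD perm_lt)
  have u: "u p \<in> carrier R" if "p permutes {..<d}" for p
    using that ij rest by (simp add: u_def aD perm_lt)
  have ins: "{..<d} = insert i ({..<d} - {i})" using ij by auto
  have split: "(\<Otimes>r\<in>{..<d}. M $$ (r, p r)) = M $$ (i, p i) \<otimes> (\<Otimes>r\<in>{..<d} - {i}. M $$ (r, p r))"
    if "M \<in> mat_over R d" "p permutes {..<d}" for M p
    by (subst ins, rule finprod_insert) (use that ij in \<open>auto simp: mat_overD perm_lt\<close>)
  \<comment> \<open>Composing with the transposition swaps the columns chosen in rows i and j, and
    both of these rows are now row j of A.\<close>
  have uinv: "u (p \<circ> transpose i j) = u p" if p: "p permutes {..<d}" for p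
  proof -
    have e: "{..<d} - {i} = insert j ({..<d} - {i, j})" using ij by auto
    let ?w = "\<Otimes>r\<in>{..<d} - {i, j}. A $$ (r, p r)"
    have w: "?w \<in> carrier R" by (intro finprod_closed) (auto simp: aD perm_lt[OF p])
    have "rest p = A $$ (j, p j) \<otimes> ?w"
      unfolding rest_def e by (rule finprod_insert) (use ij in \<open>auto simp: aD perm_lt[OF p]\<close>)
    moreover have "rest (p \<circ> transpose i j) = A $$ (j, p i) \<otimes> ?w"
    proof -
      have "rest (p \<circ> transpose i j) = A $$ (j, (p \<circ> transpose i j) j) \<otimes>
          (\<Otimes>r\<in>{..<d} - {i, j}. A $$ (r, (p \<circ> transpose i j) r))"
        unfolding rest_def e
        by (rule finprod_insert)
          (use ij in \<open>auto simp: aD perm_lt[OF p] transpose_def\<close>)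
      also have "(\<Otimes>r\<in>{..<d} - {i, j}. A $$ (r, (p \<circ> transpose i j) r)) = ?w"
        by (intro finprod_cong') (auto simp: aD perm_lt[OF p] transpose_def)
      finally show ?thesis by (simp add: o_def)
    qed
    ultimately show ?thesis
      using ij w by (simp add: u_def aD perm_lt[OF p] m_lcomm)
  qed
  have "det_over R d ?B = (\<Oplus>p\<in>{p. p permutes {..<d}}.
      sign_over R p \<otimes> (\<Otimes>r\<in>{..<d}. A $$ (r, p r)) \<oplus> s \<otimes> (sign_over R p \<otimes> u p))"
    unfolding det_over_sign
  proof (intro finsum_cong' refl)
    fix p assume "p \<in> {p. p permutes {..<d}}"
    then have p: "p permutes {..<d}" by simp
    have "(\<Otimes>r\<in>{..<d} - {i}. ?B $$ (r, p r)) = rest p"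
      unfolding rest_def using ij s
      by (intro finprod_cong') (auto simp: aD perm_lt[OF p] mult_elementary_left[OF s A])
    moreover have "?B $$ (i, p i) = A $$ (i, p i) \<oplus> s \<otimes> A $$ (j, p i)"
      using ij by (simp add: mult_elementary_left[OF s A] perm_lt[OF p])
    ultimately have "(\<Otimes>r\<in>{..<d}. ?B $$ (r, p r)) = (A $$ (i, p i) \<oplus> s \<otimes> A $$ (j, p i)) \<otimes> rest p"
      using split[OF mult_over_closed[OF elementary_closed[OF s] A] p] by simp
    also have "\<dots> = (\<Otimes>r\<in>{..<d}. A $$ (r, p r)) \<oplus> s \<otimes> u p"
      using ij s rest[OF p] unfolding split[OF A p] rest_def[symmetric] u_def
      by (simp add: aD perm_lt[OF p] l_distr m_assoc)
    finally show "sign_over R p \<otimes> (\<Otimes>r\<in>{..<d}. ?B $$ (r, p r)) =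
        sign_over R p \<otimes> (\<Otimes>r\<in>{..<d}. A $$ (r, p r)) \<oplus> s \<otimes> (sign_over R p \<otimes> u p)"
      using s u[OF p] by (simp add: sign_over_closed r_distr m_lcomm aD perm_lt[OF p] finprod_closed Pi_iff)
  qed (use s u in \<open>auto simp: sign_over_closed aD perm_lt intro!: finprod_closed\<close>)
  also have "\<dots> = det_over R d A \<oplus> (\<Oplus>p\<in>{p. p permutes {..<d}}. s \<otimes> (sign_over R p \<otimes> u p))"
    unfolding det_over_sign using s u
    by (intro finsum_addf) (auto simp: sign_over_closed aD perm_lt intro!: finprod_closed)
  also have "(\<Oplus>p\<in>{p. p permutes {..<d}}. s \<otimes> (sign_over R p \<otimes> u p)) =
      s \<otimes> (\<Oplus>p\<in>{p. p permutes {..<d}}. sign_over R p \<otimes> u p)"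
    using s u by (intro finsum_rdistr[symmetric]) (auto simp: sign_over_closed finite_permutations)
  also have "\<dots> = \<zero>" using alternating_sum_zero[of i d j u, OF ij u uinv] s by simp
  also have "det_over R d A \<oplus> \<zero> = det_over R d A"
  proof -
    have "det_over R d A \<in> carrier R"
      unfolding det_over_sign
      by (intro finsum_closed) (auto simp: sign_over_closed aD perm_lt intro!: finprod_closed)
    then show ?thesis by simp
  qed
  finally show ?thesis .
qed

end

section \<open>Row reduction in the special linear group\<close>

lemma SL_simps:
  "A \<in> carrier (SL d F) \<longleftrightarrow> A \<in> mat_over F d \<and> det_over F d A = \<one>\<^bsub>F\<^esub>"
  "A \<otimes>\<^bsub>SL d F\<^esub> B = mult_over F d A B" "\<one>\<^bsub>SL d F\<^esub> = one_over F d"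
  by (simp_all add: SL_def)

definition unit_cols :: "('a, 'm) ring_scheme \<Rightarrow> nat \<Rightarrow> nat \<Rightarrow> 'a mat \<Rightarrow> bool" where
  "unit_cols F d k A \<longleftrightarrow> (\<forall>c<k. \<forall>r<d. A $$ (r, c) = (if r = c then \<one>\<^bsub>F\<^esub> else \<zero>\<^bsub>F\<^esub>))"

context field
begin

text \<open>Row j vanishes in the first k columns because k \<le> j, so adding a multiple of it does
  not disturb them.\<close>

lemma unit_cols_elementary:
  assumes "unit_cols R d k A" "A \<in> mat_over R d" "s \<in> carrier R" "i < d" "j < d" "i \<noteq> j" "k \<le> j"
  shows "unit_cols R d k (mult_over R d (elementary R d i j s) A)"
  using assms by (auto simp: unit_cols_def mult_elementary_left)

text \<open>The only nonzero entry of column c is in row c, so the row that p sends to c must be c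
  itself.\<close>

lemma unit_cols_nonzero_fixed:
  assumes A: "unit_cols R d k A" "k \<le> d" and p: "p permutes {..<d}"
    and nz: "\<And>i. i < d \<Longrightarrow> A $$ (i, p i) \<noteq> \<zero>" and c: "c < k"
  shows "p c = c"
proof -
  define i where "i = inv_into UNIV p c"
  have pi: "p i = c" using permutes_inverses(1)[OF p] by (simp add: i_def)
  then have "i < d" using permutes_in_image[OF p, of i] c A(2) by simp
  then have "i = c" using nz[of i] A(1) c pi by (auto simp: unit_cols_def split: if_splits)
  then show ?thesis using pi by simp
qed

text \<open>A permutation without zero factor fixes every c < k, so the row that it sends to column
  k has index at least k, where the entry is zero.\<close>

lemma unit_cols_det_zero:
  assumes A: "A \<in> mat_over R d" "unit_cols R d k A" and k: "k < d"
    and z: "\<And>i. k \<le> i \<Longrightarrow> i < d \<Longrightarrow> A $$ (i, k) = \<zero>"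
  shows "det_over R d A = \<zero>"
proof (rule det_over_eq_zero[OF A(1)])
  fix p assume p: "p permutes {..<d}"
  show "\<exists>i<d. A $$ (i, p i) = \<zero>"
  proof (rule ccontr)
    assume "\<not> ?thesis"
    then have nz: "\<And>i. i < d \<Longrightarrow> A $$ (i, p i) \<noteq> \<zero>" by blast
    define i where "i = inv_into UNIV p k"
    have pi: "p i = k" using permutes_inverses(1)[OF p] by (simp add: i_def)
    then have "i < d" using permutes_in_image[OF p, of i] k by simp
    then have "i < k" using nz[of i] z[of i] pi by force
    then have "p i = i" by (intro unit_cols_nonzero_fixed[OF A(2) _ p nz]) (use k in auto)
    then show False using pi \<open>i < k\<close> by simp
  qed
qed

text \<open>A nonvanishing term fixes 0, ..., d - 2 and hence also d - 1, so only the identity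
  permutation contributes.\<close>

lemma unit_cols_det_last:
  assumes A: "A \<in> mat_over R d" "unit_cols R d (d - 1) A" and d: "d > 0"
  shows "det_over R d A = A $$ (d - 1, d - 1)"
proof -
  have "det_over R d A = sign_over R id \<otimes> (\<Otimes>i\<in>{..<d}. A $$ (i, id i))"
  proof (rule det_over_single[OF A(1) permutes_id])
    fix p :: "nat \<Rightarrow> nat" assume p: "p permutes {..<d}" "p \<noteq> id"
    show "\<exists>i<d. A $$ (i, p i) = \<zero>"
    proof (rule ccontr)
      assume "\<not> ?thesis"
      then have nz: "\<And>i. i < d \<Longrightarrow> A $$ (i, p i) \<noteq> \<zero>" by blast
      have fixed: "p c = c" if "c < d - 1" for c
        by (rule unit_cols_nonzero_fixed[OF A(2) _ p(1) nz that]) auto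
      have "p permutes {d - 1}"
        by (rule permutes_superset[OF p(1)]) (use fixed d in auto)
      then show False using p(2) by simp
    qed
  qed
  also have "(\<Otimes>i\<in>{..<d}. A $$ (i, id i)) =
      (\<Otimes>i\<in>{..<d}. if d - 1 = i then A $$ (i, i) else \<one>)"
    using A(2) d by (intro finprod_cong') (auto simp: unit_cols_def mat_overD[OF A(1)])
  also have "\<dots> = A $$ (d - 1, d - 1)"
    by (rule finprod_singleton) (use d in \<open>auto simp: mat_overD[OF A(1)]\<close>)
  finally show ?thesis using d by (simp add: sign_over_def mat_overD[OF A(1)])
qed

lemma elementary_mult_SL:
  assumes "s \<in> carrier R" "A \<in> carrier (SL d R)" "i < d" "j < d" "i \<noteq> j"
  shows "mult_over R d (elementary R d i j s) A \<in> carrier (SL d R)"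
  using assms by (simp add: SL_simps mult_over_closed elementary_closed det_over_elementary_mult)

text \<open>Gaussian elimination by row additions only, packaged as an induction so that it
  presupposes no group structure: closure under products and existence of inverses are themselves
  derived from it.\<close>

lemma SL_induct [consumes 1, case_names one step]:
  assumes "A \<in> carrier (SL d R)"
    and one: "P (one_over R d)"
    and step: "\<And>i j s A. i < d \<Longrightarrow> j < d \<Longrightarrow> i \<noteq> j \<Longrightarrow> s \<in> carrier R \<Longrightarrow> A \<in> carrier (SL d R) \<Longrightarrow>
      P A \<Longrightarrow> P (mult_over R d (elementary R d i j s) A)"
  shows "P A"
proof -
  \<comment> \<open>A row addition is undone by the one with parameter -s, so P may be pulled back
    along each reduction.\<close>
  have unstep: "P A" if P: "P (mult_over R d (elementary R d i j s) A)"
    and "i < d" "j < d" "i \<noteq> j" "s \<in> carrier R" and A: "A \<in> carrier (SL d R)" for i j s A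
  proof -
    note ij = that(2-4) and s = that(5)
    have "P (mult_over R d (elementary R d i j (\<ominus> s)) (mult_over R d (elementary R d i j s) A))"
      by (rule step) (use ij s A P in \<open>simp_all add: elementary_mult_SL\<close>)
    moreover have "mult_over R d (elementary R d i j (\<ominus> s)) (mult_over R d (elementary R d i j s) A) =
        mult_over R d (one_over R d) A"
      using ij s A by (simp add: SL_simps mult_over_assoc[symmetric] elementary_closed elementary_add
          elementary_zero l_neg)
    ultimately show "P A" using A by (simp add: SL_simps one_over_mult)
  qed
  have main: "unit_cols R d k A \<Longrightarrow> A \<in> carrier (SL d R) \<Longrightarrow> k \<le> d \<Longrightarrow> P A" for k A
  proof (induction "d - k" arbitrary: k A)
    case 0
    then have "A = one_over R d"
      by (intro mat_over_eqI[of _ R d]) (auto simp: SL_simps one_over_closed unit_cols_def one_over_index)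
    then show ?case using one by simp
  next
    case (Suc m)
    then have k: "k < d" by simp
    have IH: "P B" if "unit_cols R d (Suc k) B" "B \<in> carrier (SL d R)" for B
      using Suc.hyps(1)[of "Suc k" B] Suc.hyps(2) that k by simp
    \<comment> \<open>Once the pivot is one, column k is cleared from the bottom upwards; n bounds
      the rows that may still hold a nonzero entry.\<close>
    have clear: "P B" if "unit_cols R d k B" "B \<in> carrier (SL d R)" "B $$ (k, k) = \<one>"
        "\<And>r. n \<le> r \<Longrightarrow> r < d \<Longrightarrow> r \<noteq> k \<Longrightarrow> B $$ (r, k) = \<zero>" for B n
      using that
    proof (induction n arbitrary: B)
      case 0
      then have "unit_cols R d (Suc k) B" by (auto simp: unit_cols_def less_Suc_eq)
      then show ?case using IH 0 by blast
    next
      case (Suc n)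
      show ?case
      proof (cases "n < d \<and> n \<noteq> k")
        case False
        have "B $$ (r, k) = \<zero>" if "n \<le> r" "r < d" "r \<noteq> k" for r
          using Suc.prems(4)[of r] that False by (cases "r = n") auto
        then show ?thesis using Suc.IH[of B] Suc.prems by blast
      next
        case True
        have B: "B \<in> mat_over R d" using Suc.prems(2) by (simp add: SL_simps)
        let ?s = "\<ominus> (B $$ (n, k))"
        let ?C = "mult_over R d (elementary R d n k ?s) B"
        have s: "?s \<in> carrier R" using True k by (simp add: mat_overD[OF B])
        have "P ?C"
        proof (rule Suc.IH)
          show "unit_cols R d k ?C" using Suc.prems(1) B s True k by (intro unit_cols_elementary) auto
          show "?C \<in> carrier (SL d R)" using Suc.prems(2) s True k by (intro elementary_mult_SL) auto
          show "?C $$ (k, k) = \<one>"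
            using True k Suc.prems(3) by (simp add: mult_elementary_left[OF s B])
          fix r assume r: "n \<le> r" "r < d" "r \<noteq> k"
          show "?C $$ (r, k) = \<zero>"
            using True k r s Suc.prems(3) Suc.prems(4)[of r] mat_overD[OF B, of n k]
            by (cases "r = n") (simp_all add: mult_elementary_left[OF s B] r_neg)
        qed
        then show ?thesis using True k s Suc.prems(2) by (intro unstep[of n k ?s B]) auto
      qed
    qed
    \<comment> \<open>A nonzero entry b below the diagonal makes the pivot one by adding (1 -
      B_kk)/b times its row to row k. Scaling a row instead would change the determinant.\<close>
    have pivot_below: "P B" if B: "unit_cols R d k B" "B \<in> carrier (SL d R)"
      and i: "k < i" "i < d" "B $$ (i, k) \<noteq> \<zero>" for B i
    proof -
      have Bm: "B \<in> mat_over R d" using B(2) by (simp add: SL_simps)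
      let ?b = "B $$ (i, k)"
      let ?s = "(\<one> \<ominus> B $$ (k, k)) \<otimes> inv ?b"
      let ?C = "mult_over R d (elementary R d k i ?s) B"
      have b: "?b \<in> Units R" "?b \<in> carrier R" "B $$ (k, k) \<in> carrier R"
        using i k mat_overD[OF Bm] by (auto simp: field_Units)
      have s: "?s \<in> carrier R" using b by simp
      have "?s \<otimes> ?b = \<one> \<ominus> B $$ (k, k)" using b by (simp add: m_assoc)
      moreover have "?C $$ (k, k) = B $$ (k, k) \<oplus> ?s \<otimes> ?b"
        using i k by (subst mult_elementary_left[OF s Bm]) simp_all
      ultimately have "?C $$ (k, k) = \<one>"
        using b by (simp add: minus_eq a_lcomm r_neg)
      moreover have "unit_cols R d k ?C" using B Bm s i k by (intro unit_cols_elementary) auto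
      moreover have "?C \<in> carrier (SL d R)" using B s i k by (intro elementary_mult_SL) auto
      ultimately have "P ?C" using clear[of ?C d] by simp
      then show "P B" using i k s B(2) by (intro unstep[of k i ?s B]) auto
    qed
    have Am: "A \<in> mat_over R d" "det_over R d A = \<one>" using Suc.prems(2) by (simp_all add: SL_simps)
    show ?case
    proof (cases "k = d - 1")
      case True
      \<comment> \<open>In the last column no lower row is left to adjust the pivot; the determinant
        forces it to be one.\<close>
      then have "A $$ (k, k) = \<one>" using unit_cols_det_last[OF Am(1)] Suc.prems(1) Am(2) k by simp
      then show ?thesis using clear[of A d] Suc.prems by simp
    next
      case False
      obtain i where i: "k \<le> i" "i < d" "A $$ (i, k) \<noteq> \<zero>"
        using unit_cols_det_zero[OF Am(1) Suc.prems(1) k] Am(2) by fastforce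
      show ?thesis
      proof (cases "i = k")
        case False
        then show ?thesis using pivot_below[of A i] i Suc.prems by simp
      next
        case True
        have k1: "Suc k < d" using k False by simp
        show ?thesis
        proof (cases "A $$ (Suc k, k) = \<zero>")
          case False
          then show ?thesis using pivot_below[of A "Suc k"] k1 Suc.prems by simp
        next
          case zero: True
          \<comment> \<open>Only the diagonal entry is known to be nonzero; adding row k to the next
            row copies it below the diagonal.\<close>
          let ?C = "mult_over R d (elementary R d (Suc k) k \<one>) A"
          have "?C $$ (Suc k, k) \<noteq> \<zero>"
            using i True zero k1 mat_overD[OF Am(1), of k k]
            by (simp add: mult_elementary_left[OF one_closed Am(1)])
          moreover have "unit_cols R d k ?C" using Suc.prems Am k1 by (intro unit_cols_elementary) auto
          moreover have "?C \<in> carrier (SL d R)" using Suc.prems k1 by (intro elementary_mult_SL) auto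
          ultimately have "P ?C" using pivot_below[of ?C "Suc k"] k1 by simp
          then show ?thesis using k1 Suc.prems by (intro unstep[of "Suc k" k \<one> A]) auto
        qed
      qed
    qed
  qed
  show ?thesis using main[of 0 A] assms(1) by (simp add: unit_cols_def)
qed

section \<open>The special linear group and its elementary generators\<close>

lemma one_over_SL: "one_over R d \<in> carrier (SL d R)"
  by (simp add: SL_simps one_over_closed det_over_one)

lemma elementary_SL:
  assumes "s \<in> carrier R" "i < d" "j < d" "i \<noteq> j"
  shows "elementary R d i j s \<in> carrier (SL d R)"
  using elementary_mult_SL[OF assms(1) one_over_SL assms(2-4)] assms by (simp add: elementary_mult_one)

text \<open>Induction on the left factor reduces this to row additions, which preserve the
  determinant; the product formula for determinants is bypassed.\<close>

lemma SL_mult_closed: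
  assumes A: "A \<in> carrier (SL d R)" and B: "B \<in> carrier (SL d R)"
  shows "mult_over R d A B \<in> carrier (SL d R)"
  using A
proof (induction rule: SL_induct)
  case one
  then show ?case using B by (simp add: SL_simps one_over_mult)
next
  case (step i j s A)
  then have "mult_over R d (mult_over R d (elementary R d i j s) A) B =
      mult_over R d (elementary R d i j s) (mult_over R d A B)"
    using B by (simp add: SL_simps mult_over_assoc elementary_closed)
  then show ?case using step by (simp add: elementary_mult_SL)
qed

text \<open>Left inverses are built along the induction: if B inverts A, then B E_ij(-s) inverts
  E_ij(s) A.\<close>

lemma group_SL: "group (SL d R)"
proof (rule groupI)
  fix A assume "A \<in> carrier (SL d R)"
  then show "\<exists>B\<in>carrier (SL d R). B \<otimes>\<^bsub>SL d R\<^esub> A = \<one>\<^bsub>SL d R\<^esub>"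
  proof (induction rule: SL_induct)
    case one
    show ?case
      by (rule bexI[OF _ one_over_SL]) (simp add: SL_simps(2,3) one_over_mult one_over_closed)
  next
    case (step i j s A)
    then obtain B where B: "B \<in> carrier (SL d R)" "mult_over R d B A = one_over R d"
      by (auto simp: SL_simps(2,3))
    let ?E = "elementary R d i j"
    have E: "?E (\<ominus> s) \<in> carrier (SL d R)" using step by (intro elementary_SL) auto
    have "mult_over R d (?E (\<ominus> s)) (mult_over R d (?E s) A) = mult_over R d (one_over R d) A"
      using step by (simp add: SL_simps mult_over_assoc[symmetric] elementary_closed elementary_add
          elementary_zero l_neg)
    then have "mult_over R d (mult_over R d B (?E (\<ominus> s))) (mult_over R d (?E s) A) = one_over R d"
      using step B by (simp add: SL_simps mult_over_assoc elementary_closed mult_over_closed one_over_mult)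
    then show ?case using SL_mult_closed[OF B(1) E] by (auto simp: SL_simps(2,3))
  qed
qed (auto simp: SL_simps(2,3) SL_mult_closed one_over_SL, auto simp: SL_simps mult_over_assoc one_over_mult)

lemma SL_generated_by_elementary:
  assumes K: "subgroup K (SL d R)"
    and E: "\<And>i j s. i < d \<Longrightarrow> j < d \<Longrightarrow> i \<noteq> j \<Longrightarrow> s \<in> carrier R \<Longrightarrow> elementary R d i j s \<in> K"
  shows "K = carrier (SL d R)"
proof (intro equalityI subsetI)
  fix A assume "A \<in> carrier (SL d R)"
  then show "A \<in> K"
  proof (induction rule: SL_induct)
    case one
    show ?case using subgroup.one_closed[OF K] by (simp add: SL_simps)
  next
    case (step i j s A)
    then show ?case using subgroup.m_closed[OF K E] by (simp add: SL_simps(2))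
  qed
qed (use subgroup.subset[OF K] in auto)

end

section \<open>A relation violated by the inverse pair\<close>

text \<open>Tests whether the factor b by which g1 scales a root subgroup containing c satisfies 1 +
  b = b^n. It is defined in any group so that it can be formed in \<open>Delta_plus\<close> and then
  evaluated at both pairs.\<close>

definition relator :: "('a, 'm) monoid_scheme \<Rightarrow> nat \<Rightarrow> 'a \<Rightarrow> 'a \<Rightarrow> 'a" where
  "relator G n g1 g2 =
    (let c = g1 \<otimes>\<^bsub>G\<^esub> g2 \<otimes>\<^bsub>G\<^esub> inv\<^bsub>G\<^esub> g1 \<otimes>\<^bsub>G\<^esub> inv\<^bsub>G\<^esub> g2
     in c \<otimes>\<^bsub>G\<^esub> (g1 \<otimes>\<^bsub>G\<^esub> c \<otimes>\<^bsub>G\<^esub> inv\<^bsub>G\<^esub> g1) \<otimes>\<^bsub>G\<^esub>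
        (g1 [^]\<^bsub>G\<^esub> n \<otimes>\<^bsub>G\<^esub> inv\<^bsub>G\<^esub> c \<otimes>\<^bsub>G\<^esub> inv\<^bsub>G\<^esub> (g1 [^]\<^bsub>G\<^esub> n)))"

lemma (in group) relator_closed:
  "g1 \<in> carrier G \<Longrightarrow> g2 \<in> carrier G \<Longrightarrow> relator G n g1 g2 \<in> carrier G"
  by (simp add: relator_def Let_def)

lemma (in group_hom) hom_relator:
  "g1 \<in> carrier G \<Longrightarrow> g2 \<in> carrier G \<Longrightarrow> h (relator G n g1 g2) = relator H n (h g1) (h g2)"
  by (simp add: relator_def Let_def hom_nat_pow)

text \<open>Isolates what the argument needs from the matrices: \<open>T\<close> parametrizes a root
  subgroup, h and k are the torus elements x and w x w^-1. The inequalities \<open>a1\<close>,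
  \<open>a2\<close>, \<open>a3\<close> respectively make c nontrivial, let 1 + a be a power of a,
  and prevent the inverted relation from holding.\<close>

locale root_group = G: group G + F: field F
  for G :: "('a, 'm) monoid_scheme" (structure) and F :: "('b, 'n) ring_scheme" +
  fixes T :: "'b \<Rightarrow> 'a" and a :: 'b and h k w :: 'a
  assumes T_closed [simp]: "s \<in> carrier F \<Longrightarrow> T s \<in> carrier G"
    and T_add: "s \<in> carrier F \<Longrightarrow> t \<in> carrier F \<Longrightarrow> T s \<otimes> T t = T (s \<oplus>\<^bsub>F\<^esub> t)"
    and hkw [simp]: "h \<in> carrier G" "k \<in> carrier G" "w \<in> carrier G"
    and hT: "s \<in> carrier F \<Longrightarrow> h \<otimes> T s = T (a \<otimes>\<^bsub>F\<^esub> s) \<otimes> h"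
    and kT: "s \<in> carrier F \<Longrightarrow> k \<otimes> T s = T (a \<otimes>\<^bsub>F\<^esub> s) \<otimes> k"
    and wh: "w \<otimes> h = k \<otimes> w" and hk: "h \<otimes> k = k \<otimes> h"
    and a [simp]: "a \<in> carrier F" and a0: "a \<noteq> \<zero>\<^bsub>F\<^esub>"
    and primitive: "s \<in> carrier F \<Longrightarrow> s \<noteq> \<zero>\<^bsub>F\<^esub> \<Longrightarrow> \<exists>n::nat. s = a [^]\<^bsub>F\<^esub> n"
    and a1: "a \<noteq> \<one>\<^bsub>F\<^esub>" and a2: "\<one>\<^bsub>F\<^esub> \<oplus>\<^bsub>F\<^esub> a \<noteq> \<zero>\<^bsub>F\<^esub>"
    and a3: "\<one>\<^bsub>F\<^esub> \<oplus>\<^bsub>F\<^esub> a \<oplus>\<^bsub>F\<^esub> a \<otimes>\<^bsub>F\<^esub> a \<noteq> \<zero>\<^bsub>F\<^esub>"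
    and subgroup_full: "subgroup K G \<Longrightarrow> T ` carrier F \<subseteq> K \<Longrightarrow>
      (\<And>u. u \<in> K \<Longrightarrow> w \<otimes> u \<otimes> inv w \<in> K) \<Longrightarrow> K = carrier G"
begin

definition y :: 'a where "y = T \<one>\<^bsub>F\<^esub> \<otimes> w"

text \<open>This is y h y^-1: moving T(-1) through k turns T(1) k T(-1) into T(1 - a) k.\<close>

definition M :: 'a where "M = T (\<one>\<^bsub>F\<^esub> \<ominus>\<^bsub>F\<^esub> a) \<otimes> k"

text \<open>Equal to -(1 - a)^2; the commutator of h and \<open>M\<close> is
  \<open>T u\<close>.\<close>

definition u :: 'b where "u = a \<otimes>\<^bsub>F\<^esub> (\<one>\<^bsub>F\<^esub> \<ominus>\<^bsub>F\<^esub> a) \<ominus>\<^bsub>F\<^esub> (\<one>\<^bsub>F\<^esub> \<ominus>\<^bsub>F\<^esub> a)"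

text \<open>The commutator of M^-1 and h^-1 is \<open>T v\<close>; the two factors a^-1 compensate
  for carrying a root element past \<open>M\<close> and h.\<close>

definition v :: 'b where "v = \<ominus>\<^bsub>F\<^esub> (inv\<^bsub>F\<^esub> a \<otimes>\<^bsub>F\<^esub> (inv\<^bsub>F\<^esub> a \<otimes>\<^bsub>F\<^esub> u))"

lemma closed [simp]: "y \<in> carrier G" "M \<in> carrier G" "u \<in> carrier F" "v \<in> carrier F"
  "inv\<^bsub>F\<^esub> a \<in> carrier F"
proof -
  show i: "inv\<^bsub>F\<^esub> a \<in> carrier F" using a0 by (simp add: F.field_Units)
  show u: "u \<in> carrier F" by (simp add: u_def)
  show "y \<in> carrier G" "M \<in> carrier G" by (simp_all add: y_def M_def)
  show "v \<in> carrier F" using i u by (simp add: v_def)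
qed

lemma a_inv: "a \<otimes>\<^bsub>F\<^esub> inv\<^bsub>F\<^esub> a = \<one>\<^bsub>F\<^esub>" "s \<in> carrier F \<Longrightarrow> a \<otimes>\<^bsub>F\<^esub> (inv\<^bsub>F\<^esub> a \<otimes>\<^bsub>F\<^esub> s) = s"
proof -
  show "a \<otimes>\<^bsub>F\<^esub> inv\<^bsub>F\<^esub> a = \<one>\<^bsub>F\<^esub>" using a0 by (simp add: F.field_Units)
  then show "s \<in> carrier F \<Longrightarrow> a \<otimes>\<^bsub>F\<^esub> (inv\<^bsub>F\<^esub> a \<otimes>\<^bsub>F\<^esub> s) = s"
    by (simp add: F.m_assoc[symmetric])
qed

lemma T_zero: "T \<zero>\<^bsub>F\<^esub> = \<one>"
  using T_add[of "\<zero>\<^bsub>F\<^esub>" "\<zero>\<^bsub>F\<^esub>"] G.l_cancel_one[of "T \<zero>\<^bsub>F\<^esub>" "T \<zero>\<^bsub>F\<^esub>"] by simp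

lemma T_inv: "s \<in> carrier F \<Longrightarrow> inv (T s) = T (\<ominus>\<^bsub>F\<^esub> s)"
  by (rule G.inv_equality) (simp_all add: T_add T_zero F.l_neg)

lemma T_add_left:
  "s \<in> carrier F \<Longrightarrow> t \<in> carrier F \<Longrightarrow> g \<in> carrier G \<Longrightarrow> T s \<otimes> (T t \<otimes> g) = T (s \<oplus>\<^bsub>F\<^esub> t) \<otimes> g"
  by (simp add: T_add[symmetric] G.m_assoc)

lemma hT_left: "s \<in> carrier F \<Longrightarrow> g \<in> carrier G \<Longrightarrow> h \<otimes> (T s \<otimes> g) = T (a \<otimes>\<^bsub>F\<^esub> s) \<otimes> (h \<otimes> g)"
  using hT by (simp add: G.m_assoc[symmetric])

lemma kT_left: "s \<in> carrier F \<Longrightarrow> g \<in> carrier G \<Longrightarrow> k \<otimes> (T s \<otimes> g) = T (a \<otimes>\<^bsub>F\<^esub> s) \<otimes> (k \<otimes> g)"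
  using kT by (simp add: G.m_assoc[symmetric])

lemma yh: "y \<otimes> h = M \<otimes> y"
proof -
  have "\<one>\<^bsub>F\<^esub> \<ominus>\<^bsub>F\<^esub> a \<oplus>\<^bsub>F\<^esub> a = \<one>\<^bsub>F\<^esub>" by (simp add: F.minus_eq F.a_assoc F.l_neg)
  then show ?thesis by (simp add: y_def M_def G.m_assoc wh kT_left T_add_left)
qed

lemma MT: "s \<in> carrier F \<Longrightarrow> M \<otimes> T s = T (a \<otimes>\<^bsub>F\<^esub> s) \<otimes> M"
  by (simp add: M_def G.m_assoc kT T_add_left F.a_comm)

lemma hM: "h \<otimes> M = T u \<otimes> (M \<otimes> h)"
proof -
  have "u \<oplus>\<^bsub>F\<^esub> (\<one>\<^bsub>F\<^esub> \<ominus>\<^bsub>F\<^esub> a) = a \<otimes>\<^bsub>F\<^esub> (\<one>\<^bsub>F\<^esub> \<ominus>\<^bsub>F\<^esub> a)"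
    unfolding u_def by (simp add: F.minus_eq[of "a \<otimes>\<^bsub>F\<^esub> _"] F.a_assoc F.l_neg)
  then show ?thesis by (simp add: M_def G.m_assoc hT_left T_add_left hk)
qed

text \<open>The root element stands on the right so that inverting the equation yields M^-1 h^-1 =
  T(v) h^-1 M^-1, the form needed at the inverse pair.\<close>

lemma Mh: "M \<otimes> h = h \<otimes> M \<otimes> T v"
proof -
  have "a \<otimes>\<^bsub>F\<^esub> (a \<otimes>\<^bsub>F\<^esub> v) = \<ominus>\<^bsub>F\<^esub> u"
    by (simp add: v_def F.r_minus a_inv)
  then have "T u \<otimes> (h \<otimes> M \<otimes> T v) = T u \<otimes> (T (\<ominus>\<^bsub>F\<^esub> u) \<otimes> (h \<otimes> M))"
    by (simp add: G.m_assoc MT hT_left)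
  also have "\<dots> = T (u \<oplus>\<^bsub>F\<^esub> \<ominus>\<^bsub>F\<^esub> u) \<otimes> (h \<otimes> M)" by (rule T_add_left) simp_all
  also have "\<dots> = T u \<otimes> (M \<otimes> h)" by (simp add: F.r_neg T_zero hM)
  finally show ?thesis by simp
qed

lemma u0: "u \<noteq> \<zero>\<^bsub>F\<^esub>"
proof
  assume "u = \<zero>\<^bsub>F\<^esub>"
  then have "a \<otimes>\<^bsub>F\<^esub> (\<one>\<^bsub>F\<^esub> \<ominus>\<^bsub>F\<^esub> a) = \<one>\<^bsub>F\<^esub> \<otimes>\<^bsub>F\<^esub> (\<one>\<^bsub>F\<^esub> \<ominus>\<^bsub>F\<^esub> a)" by (simp add: u_def)
  moreover have "\<one>\<^bsub>F\<^esub> \<ominus>\<^bsub>F\<^esub> a \<noteq> \<zero>\<^bsub>F\<^esub>" using a1 by simp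
  ultimately show False
    using a1 F.m_rcancel[of "\<one>\<^bsub>F\<^esub> \<ominus>\<^bsub>F\<^esub> a" a "\<one>\<^bsub>F\<^esub>"] by simp
qed

lemma v0: "v \<noteq> \<zero>\<^bsub>F\<^esub>"
proof
  assume "v = \<zero>\<^bsub>F\<^esub>"
  then have "inv\<^bsub>F\<^esub> a \<otimes>\<^bsub>F\<^esub> (inv\<^bsub>F\<^esub> a \<otimes>\<^bsub>F\<^esub> u) = \<zero>\<^bsub>F\<^esub>"
    using F.minus_minus[of "inv\<^bsub>F\<^esub> a \<otimes>\<^bsub>F\<^esub> (inv\<^bsub>F\<^esub> a \<otimes>\<^bsub>F\<^esub> u)"] by (simp add: v_def)
  moreover have "inv\<^bsub>F\<^esub> a \<noteq> \<zero>\<^bsub>F\<^esub>" using a_inv(1) by auto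
  ultimately show False using u0 by (simp add: F.integral_iff)
qed

text \<open>All factors lie in T(F): conjugation by g1 multiplies the parameter by b, that by its
  n-th power by b^n, and the inverse of c supplies the minus sign.\<close>

lemma relator_root:
  assumes g: "g1 \<in> carrier G" "g2 \<in> carrier G" and bs: "b \<in> carrier F" "s \<in> carrier F"
    and comm: "g1 \<otimes> g2 = T s \<otimes> (g2 \<otimes> g1)"
    and act: "\<And>t. t \<in> carrier F \<Longrightarrow> g1 \<otimes> T t = T (b \<otimes>\<^bsub>F\<^esub> t) \<otimes> g1"
  shows "relator G n g1 g2 = T ((\<one>\<^bsub>F\<^esub> \<oplus>\<^bsub>F\<^esub> b \<ominus>\<^bsub>F\<^esub> b [^]\<^bsub>F\<^esub> n) \<otimes>\<^bsub>F\<^esub> s)"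
proof -
  have c: "g1 \<otimes> g2 \<otimes> inv g1 \<otimes> inv g2 = T s"
    using g bs by (simp add: comm G.m_assoc G.inv_mult_group[symmetric])
  have conj: "g1 \<otimes> T s \<otimes> inv g1 = T (b \<otimes>\<^bsub>F\<^esub> s)"
    using g bs by (simp add: act G.m_assoc)
  have pow: "g1 [^] n \<otimes> T t = T (b [^]\<^bsub>F\<^esub> n \<otimes>\<^bsub>F\<^esub> t) \<otimes> g1 [^] n" if "t \<in> carrier F" for n :: nat and t
    using that
  proof (induction n arbitrary: t)
    case (Suc n)
    have "g1 [^] Suc n \<otimes> T t = g1 [^] n \<otimes> (g1 \<otimes> T t)" using g Suc.prems by (simp add: G.m_assoc)
    also have "\<dots> = (g1 [^] n \<otimes> T (b \<otimes>\<^bsub>F\<^esub> t)) \<otimes> g1" using g bs Suc.prems by (simp add: act G.m_assoc)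
    also have "\<dots> = T (b [^]\<^bsub>F\<^esub> n \<otimes>\<^bsub>F\<^esub> (b \<otimes>\<^bsub>F\<^esub> t)) \<otimes> g1 [^] n \<otimes> g1"
      using bs Suc by simp
    finally show ?case using g bs Suc.prems by (simp add: G.m_assoc F.m_assoc)
  qed (use g in simp)
  have "g1 [^] n \<otimes> inv (T s) \<otimes> inv (g1 [^] n) = T (b [^]\<^bsub>F\<^esub> n \<otimes>\<^bsub>F\<^esub> \<ominus>\<^bsub>F\<^esub> s)"
    using g bs by (simp add: T_inv pow G.m_assoc)
  then have "relator G n g1 g2 = T (s \<oplus>\<^bsub>F\<^esub> b \<otimes>\<^bsub>F\<^esub> s \<oplus>\<^bsub>F\<^esub> b [^]\<^bsub>F\<^esub> n \<otimes>\<^bsub>F\<^esub> \<ominus>\<^bsub>F\<^esub> s)"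
    using bs unfolding relator_def Let_def c conj by (simp add: T_add)
  also have "s \<oplus>\<^bsub>F\<^esub> b \<otimes>\<^bsub>F\<^esub> s \<oplus>\<^bsub>F\<^esub> b [^]\<^bsub>F\<^esub> n \<otimes>\<^bsub>F\<^esub> \<ominus>\<^bsub>F\<^esub> s =
      (\<one>\<^bsub>F\<^esub> \<oplus>\<^bsub>F\<^esub> b \<ominus>\<^bsub>F\<^esub> b [^]\<^bsub>F\<^esub> n) \<otimes>\<^bsub>F\<^esub> s"
    using bs by (simp add: F.minus_eq F.l_distr F.l_minus F.r_minus)
  finally show ?thesis .
qed

text \<open>Conjugating by powers of h gives the parameters a^n s, hence all nonzero ones. Closure
  under h alone is asked for, so that the lemma fits both the subgroup generated by h and y and a
  normal subgroup.\<close>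

lemma T_in_subgroup:
  assumes K: "subgroup K G" and s: "s \<in> carrier F" "s \<noteq> \<zero>\<^bsub>F\<^esub>" "T s \<in> K"
    and hK: "\<And>g. g \<in> K \<Longrightarrow> h \<otimes> g \<otimes> inv h \<in> K"
  shows "T ` carrier F \<subseteq> K"
proof
  fix g assume "g \<in> T ` carrier F"
  then obtain t where t: "t \<in> carrier F" "g = T t" by blast
  have pow: "T (a [^]\<^bsub>F\<^esub> n \<otimes>\<^bsub>F\<^esub> s) \<in> K" for n :: nat
  proof (induction n)
    case 0
    then show ?case using s by simp
  next
    case (Suc n)
    have "a [^]\<^bsub>F\<^esub> Suc n \<otimes>\<^bsub>F\<^esub> s = a \<otimes>\<^bsub>F\<^esub> (a [^]\<^bsub>F\<^esub> n \<otimes>\<^bsub>F\<^esub> s)"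
      using s F.m_comm[of "a [^]\<^bsub>F\<^esub> n" a] by (simp add: F.m_assoc[symmetric])
    then have "T (a [^]\<^bsub>F\<^esub> Suc n \<otimes>\<^bsub>F\<^esub> s) = h \<otimes> T (a [^]\<^bsub>F\<^esub> n \<otimes>\<^bsub>F\<^esub> s) \<otimes> inv h"
      using s by (simp only: hT F.m_closed F.nat_pow_closed a) (simp add: G.m_assoc)
    then show ?case using hK[OF Suc] by simp
  qed
  show "g \<in> K"
  proof (cases "t = \<zero>\<^bsub>F\<^esub>")
    case True
    then show ?thesis using t T_zero subgroup.one_closed[OF K] by simp
  next
    case False
    have sU: "s \<in> Units F" using s by (simp add: F.field_Units)
    then have i: "inv\<^bsub>F\<^esub> s \<in> carrier F" "inv\<^bsub>F\<^esub> s \<otimes>\<^bsub>F\<^esub> s = \<one>\<^bsub>F\<^esub>" by simp_all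
    then have "inv\<^bsub>F\<^esub> s \<noteq> \<zero>\<^bsub>F\<^esub>" using s by auto
    then have "t \<otimes>\<^bsub>F\<^esub> inv\<^bsub>F\<^esub> s \<noteq> \<zero>\<^bsub>F\<^esub>" using False t i by (simp add: F.integral_iff)
    then obtain n :: nat where "t \<otimes>\<^bsub>F\<^esub> inv\<^bsub>F\<^esub> s = a [^]\<^bsub>F\<^esub> n"
      using primitive t i by (metis F.m_closed)
    then have "t = a [^]\<^bsub>F\<^esub> n \<otimes>\<^bsub>F\<^esub> s" using t s i by (metis F.m_assoc F.r_one)
    then show ?thesis using pow t by simp
  qed
qed

lemma generate_hy: "generate G {h, y} = carrier G"
proof -
  let ?K = "generate G {h, y}"
  have K: "subgroup ?K G" by (rule G.generate_is_subgroup) simp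
  have hy: "h \<in> ?K" "y \<in> ?K" by (auto intro: generate.incl)
  note closed = subgroup.m_closed[OF K] subgroup.m_inv_closed[OF K]
  have "M = y \<otimes> h \<otimes> inv y" by (simp add: yh G.m_assoc)
  then have "M \<in> ?K" using hy closed by simp
  moreover have "T u = h \<otimes> M \<otimes> inv (M \<otimes> h)" by (simp add: hM G.m_assoc)
  ultimately have "T u \<in> ?K" using hy closed by simp
  then have T: "T ` carrier F \<subseteq> ?K"
    by (intro T_in_subgroup[OF K _ u0]) (use hy closed in auto)
  have "w = inv (T \<one>\<^bsub>F\<^esub>) \<otimes> y" by (simp add: y_def G.m_assoc[symmetric])
  moreover have "T \<one>\<^bsub>F\<^esub> \<in> ?K" using T by blast
  ultimately have w: "w \<in> ?K" using hy(2) closed by metis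
  show ?thesis by (rule subgroup_full[OF K T]) (use w closed in auto)
qed

text \<open>If \<open>x \<mapsto> inv x\<close> respected the relation \<open>1 + a = a [^] n\<close>, then \<open>(1 + a)\<^sup>2 = a\<close>.\<close>

lemma inverse_root_relation:
  assumes n: "\<one>\<^bsub>F\<^esub> \<oplus>\<^bsub>F\<^esub> a = a [^]\<^bsub>F\<^esub> (n :: nat)"
  shows "\<one>\<^bsub>F\<^esub> \<oplus>\<^bsub>F\<^esub> inv\<^bsub>F\<^esub> a \<ominus>\<^bsub>F\<^esub> inv\<^bsub>F\<^esub> a [^]\<^bsub>F\<^esub> n \<noteq> \<zero>\<^bsub>F\<^esub>"
proof
  let ?b = "inv\<^bsub>F\<^esub> a" and ?q = "\<one>\<^bsub>F\<^esub> \<oplus>\<^bsub>F\<^esub> a"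
  have b: "?b \<in> carrier F" by simp
  have qb: "?q \<otimes>\<^bsub>F\<^esub> ?b [^]\<^bsub>F\<^esub> n = \<one>\<^bsub>F\<^esub>"
    unfolding n using F.nat_pow_distrib[of a ?b n] b a_inv(1) by simp
  assume "\<one>\<^bsub>F\<^esub> \<oplus>\<^bsub>F\<^esub> ?b \<ominus>\<^bsub>F\<^esub> ?b [^]\<^bsub>F\<^esub> n = \<zero>\<^bsub>F\<^esub>"
  then have e: "\<one>\<^bsub>F\<^esub> \<oplus>\<^bsub>F\<^esub> ?b = ?b [^]\<^bsub>F\<^esub> n" using b by simp
  have "a \<otimes>\<^bsub>F\<^esub> (\<one>\<^bsub>F\<^esub> \<oplus>\<^bsub>F\<^esub> ?b) = ?q"
    using b by (simp add: F.r_distr a_inv F.a_comm)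
  then have "?q \<otimes>\<^bsub>F\<^esub> ?q = ?q \<otimes>\<^bsub>F\<^esub> (a \<otimes>\<^bsub>F\<^esub> ?b [^]\<^bsub>F\<^esub> n)" using e by simp
  also have "\<dots> = a \<otimes>\<^bsub>F\<^esub> (?q \<otimes>\<^bsub>F\<^esub> ?b [^]\<^bsub>F\<^esub> n)" by (rule F.m_lcomm) (use b in auto)
  also have "\<dots> = a" by (simp add: qb)
  finally have "(\<one>\<^bsub>F\<^esub> \<oplus>\<^bsub>F\<^esub> a \<oplus>\<^bsub>F\<^esub> a \<otimes>\<^bsub>F\<^esub> a) \<oplus>\<^bsub>F\<^esub> a = \<zero>\<^bsub>F\<^esub> \<oplus>\<^bsub>F\<^esub> a"
    by (simp add: F.l_distr F.r_distr F.a_ac)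
  then show False using a3 F.add.r_cancel[of a] by simp
qed

theorem chiral_pair_hy: "chiral_pair G h y"
proof -
  obtain n :: nat where n: "\<one>\<^bsub>F\<^esub> \<oplus>\<^bsub>F\<^esub> a = a [^]\<^bsub>F\<^esub> n"
    using primitive[of "\<one>\<^bsub>F\<^esub> \<oplus>\<^bsub>F\<^esub> a"] a2 by auto
  let ?D = Delta_plus and ?phi = "delta_hom G h y" and ?psi = "delta_hom G (inv h) (inv y)"
  interpret D: group ?D by (rule group_Delta_plus)
  interpret phi: group_hom ?D G ?phi
    by (intro group_hom.intro group_hom_axioms.intro G.delta_hom_hom D.group_axioms G.group_axioms) simp_all
  interpret psi: group_hom ?D G ?psi
    by (intro group_hom.intro group_hom_axioms.intro G.delta_hom_hom D.group_axioms G.group_axioms) simp_all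
  note rl = rho_lam_Delta_plus
  note phig = G.delta_hom_gen[of h y] and psig = G.delta_hom_gen[of "inv h" "inv y"]
  define z where "z = relator ?D n rho (lam \<otimes>\<^bsub>?D\<^esub> rho \<otimes>\<^bsub>?D\<^esub> inv\<^bsub>?D\<^esub> lam)"
  have zD: "z \<in> carrier ?D" unfolding z_def using rl by (intro D.relator_closed) simp_all
  have M: "y \<otimes> h \<otimes> inv y = M" by (simp add: yh G.m_assoc)
  have "?phi z = relator G n h (y \<otimes> h \<otimes> inv y)"
    using rl by (simp add: z_def phi.hom_relator phig)
  also have "\<dots> = T ((\<one>\<^bsub>F\<^esub> \<oplus>\<^bsub>F\<^esub> a \<ominus>\<^bsub>F\<^esub> a [^]\<^bsub>F\<^esub> n) \<otimes>\<^bsub>F\<^esub> u)"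
    unfolding M by (rule relator_root) (simp_all add: hM hT)
  also have "\<dots> = \<one>" using T_zero by (simp add: n F.minus_eq F.r_neg)
  finally have zH: "z \<in> kernel ?D G ?phi" using zD by (simp add: kernel_def)
  define N where "N = ?psi ` kernel ?D G ?phi"
  have psi_surj: "?psi ` carrier ?D = carrier G"
  proof (rule equalityI)
    have S: "subgroup (?psi ` carrier ?D) G" by (rule psi.img_is_subgroup)
    have "inv h \<in> ?psi ` carrier ?D" "inv y \<in> ?psi ` carrier ?D"
      using rl psig by (metis G.inv_closed closed(1) hkw(1) image_eqI)+
    then have "inv (inv h) \<in> ?psi ` carrier ?D" "inv (inv y) \<in> ?psi ` carrier ?D"
      by (simp_all only: subgroup.m_inv_closed[OF S])
    then have "{h, y} \<subseteq> ?psi ` carrier ?D" by simp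
    then have "generate G {h, y} \<subseteq> ?psi ` carrier ?D" by (rule G.generate_subgroup_incl[OF _ S])
    then show "carrier G \<subseteq> ?psi ` carrier ?D" by (simp only: generate_hy)
  qed auto
  \<comment> \<open>Surjectivity at the inverse pair makes the image of the normal kernel normal in
    G, so a single \<open>T\<close> element with nonzero parameter will suffice.\<close>
  have Nn: "N \<lhd> G"
    unfolding N_def
    by (rule normal.surj_hom_normal_subgroup[OF phi.normal_kernel psi.group_hom_axioms psi_surj])
  have N: "subgroup N G" and Nc: "\<And>g x. g \<in> carrier G \<Longrightarrow> x \<in> N \<Longrightarrow> g \<otimes> x \<otimes> inv g \<in> N"
    using G.normal_invE[OF Nn] by auto
  have psiz: "?psi z = relator G n (inv h) (inv y \<otimes> inv h \<otimes> y)"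
    using rl by (simp add: z_def psi.hom_relator psig)
  \<comment> \<open>Conjugation by y carries relators to relators; it turns h^-1 into M^-1 and y^-1
    h^-1 y into h^-1.\<close>
  interpret cy: group_hom G G "\<lambda>g. y \<otimes> g \<otimes> inv y"
  proof (intro group_hom.intro group_hom_axioms.intro homI)
    fix g g' assume g: "g \<in> carrier G" "g' \<in> carrier G"
    have "inv y \<otimes> (y \<otimes> (g' \<otimes> inv y)) = g' \<otimes> inv y" using g by (simp add: G.m_assoc[symmetric])
    then show "y \<otimes> (g \<otimes> g') \<otimes> inv y = y \<otimes> g \<otimes> inv y \<otimes> (y \<otimes> g' \<otimes> inv y)"
      using g by (simp add: G.m_assoc)
  qed (simp_all add: G.group_axioms)
  let ?e = "(\<one>\<^bsub>F\<^esub> \<oplus>\<^bsub>F\<^esub> inv\<^bsub>F\<^esub> a \<ominus>\<^bsub>F\<^esub> inv\<^bsub>F\<^esub> a [^]\<^bsub>F\<^esub> n) \<otimes>\<^bsub>F\<^esub> v"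
  have "y \<otimes> ?psi z \<otimes> inv y = relator G n (inv M) (inv h)"
  proof -
    have "y \<otimes> inv h \<otimes> inv y = inv M"
      unfolding M[symmetric] by (simp add: G.inv_mult_group G.m_assoc)
    moreover have "y \<otimes> (inv y \<otimes> inv h \<otimes> y) \<otimes> inv y = inv h"
    proof -
      have "y \<otimes> (inv y \<otimes> inv h \<otimes> y) \<otimes> inv y = (y \<otimes> inv y) \<otimes> inv h \<otimes> (y \<otimes> inv y)"
        by (simp only: G.m_assoc closed hkw G.inv_closed G.m_closed)
      then show ?thesis by simp
    qed
    ultimately show ?thesis unfolding psiz by (subst cy.hom_relator) simp_all
  qed
  \<comment> \<open>Here M^-1 plays g1 and h^-1 plays g2, with scaling factor a^-1 and parameter
    \<open>v\<close>.\<close>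
  also have "\<dots> = T ?e"
  proof (rule relator_root)
    have "inv (h \<otimes> M) \<otimes> (h \<otimes> M \<otimes> T v) = inv (h \<otimes> M) \<otimes> (h \<otimes> M) \<otimes> T v"
      by (rule G.m_assoc[symmetric]) simp_all
    then have "inv (h \<otimes> M) \<otimes> (M \<otimes> h) = T v" by (simp add: Mh)
    then have "T v \<otimes> inv (M \<otimes> h) = inv (h \<otimes> M) \<otimes> ((M \<otimes> h) \<otimes> inv (M \<otimes> h))"
      by (metis G.inv_closed G.m_assoc G.m_closed closed(2) hkw(1))
    also have "\<dots> = inv (h \<otimes> M)" by (subst G.r_inv) simp_all
    finally show "inv M \<otimes> inv h = T v \<otimes> (inv h \<otimes> inv M)" by (simp add: G.inv_mult_group)
    fix t assume t: "t \<in> carrier F"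
    have "M \<otimes> (T (inv\<^bsub>F\<^esub> a \<otimes>\<^bsub>F\<^esub> t) \<otimes> inv M) = T t"
      using t by (simp add: G.m_assoc[symmetric] MT a_inv) (simp add: G.m_assoc)
    then show "inv M \<otimes> T t = T (inv\<^bsub>F\<^esub> a \<otimes>\<^bsub>F\<^esub> t) \<otimes> inv M"
      using t by (metis G.inv_solve_left' G.inv_closed G.m_closed T_closed F.m_closed closed(2,5))
  qed simp_all
  finally have "y \<otimes> ?psi z \<otimes> inv y = T ?e" .
  moreover have "y \<otimes> ?psi z \<otimes> inv y \<in> N" by (rule Nc) (use zH in \<open>auto simp: N_def\<close>)
  ultimately have "T ?e \<in> N" by simp
  moreover have "?e \<noteq> \<zero>\<^bsub>F\<^esub>" using inverse_root_relation[OF n] v0 by (simp add: F.integral_iff)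
  ultimately have "T ` carrier F \<subseteq> N"
    by (intro T_in_subgroup[OF N, of ?e]) (use Nc in auto)
  then have "N = carrier G" by (rule subgroup_full[OF N]) (use Nc in auto)
  then show ?thesis using generate_hy by (simp add: chiral_pair_def N_def)
qed

end

section \<open>A chiral pair in the special linear group\<close>

text \<open>The d-cycle c -> c + 1 modulo d, fixing everything from d on as \<open>permutes\<close>
  demands.\<close>

definition shift :: "nat \<Rightarrow> nat \<Rightarrow> nat" where
  "shift d c = (if d \<le> c then c else if Suc c = d then 0 else Suc c)"

lemma shift_permutes: "shift d permutes {..<d}"
proof (rule bij_imp_permutes)
  show "bij_betw (shift d) {..<d} {..<d}"
    by (rule bij_betwI[of _ _ _ "\<lambda>c. if c = 0 then d - 1 else c - 1"]) (auto simp: shift_def)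
qed (simp add: shift_def)

lemma monomial_cong:
  assumes "\<And>c. c < d \<Longrightarrow> p c = q c" "\<And>c. c < d \<Longrightarrow> f c = g c"
  shows "monomial F d p f = monomial F d q g"
  by (rule eq_matI) (use assms in \<open>auto simp: monomial_def\<close>)

context field
begin

text \<open>The commutator of E_ij(s) with E_jk(1) is E_ik(s).\<close>

lemma elementary_in_subgroup_trans:
  assumes K: "subgroup K (SL d R)"
    and ijk: "i < d" "j < d" "k < d" "i \<noteq> j" "j \<noteq> k" "i \<noteq> k"
    and ij: "\<And>s. s \<in> carrier R \<Longrightarrow> elementary R d i j s \<in> K"
    and jk: "\<And>s. s \<in> carrier R \<Longrightarrow> elementary R d j k s \<in> K"
    and s: "s \<in> carrier R"
  shows "elementary R d i k s \<in> K"
proof -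
  interpret S: group "SL d R" by (rule group_SL)
  let ?X = "elementary R d i j s" and ?Y = "elementary R d j k \<one>" and ?Z = "elementary R d i k s"
  have XYZ: "?X \<in> carrier (SL d R)" "?Y \<in> carrier (SL d R)" "?Z \<in> carrier (SL d R)"
    using s ijk by (auto intro!: elementary_SL)
  have "?X \<otimes>\<^bsub>SL d R\<^esub> ?Y = ?Z \<otimes>\<^bsub>SL d R\<^esub> (?Y \<otimes>\<^bsub>SL d R\<^esub> ?X)"
    using elementary_commutator[of s \<one> i d j k] s ijk by (simp add: SL_simps(2))
  then have "?Z = ?X \<otimes>\<^bsub>SL d R\<^esub> ?Y \<otimes>\<^bsub>SL d R\<^esub> inv\<^bsub>SL d R\<^esub> (?Y \<otimes>\<^bsub>SL d R\<^esub> ?X)"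
    using XYZ by (intro S.inv_solve_right[THEN iffD2]) simp_all
  also have "\<dots> \<in> K"
    using ij[OF s] jk[OF one_closed] subgroup.m_closed[OF K] subgroup.m_inv_closed[OF K] by simp
  finally show ?thesis .
qed

text \<open>Conjugation by the monomial matrix moves position (i, j) one step along the cycle and,
  its entries being units, still reaches every parameter. Starting from (0, 1), this gives all
  cyclically adjacent positions; commutators supply the others.\<close>

lemma shift_closed_subgroup_full:
  assumes d: "d \<ge> 2" and K: "subgroup K (SL d R)"
    and f: "\<And>c. c < d \<Longrightarrow> f c \<in> carrier R - {\<zero>}"
    and w: "monomial R d (shift d) f \<in> carrier (SL d R)"
    and E: "\<And>s. s \<in> carrier R \<Longrightarrow> elementary R d 0 1 s \<in> K"
    and conj: "\<And>u. u \<in> K \<Longrightarrow> monomial R d (shift d) f \<otimes>\<^bsub>SL d R\<^esub> u \<otimes>\<^bsub>SL d R\<^esub>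
      inv\<^bsub>SL d R\<^esub> monomial R d (shift d) f \<in> K"
  shows "K = carrier (SL d R)"
proof -
  interpret S: group "SL d R" by (rule group_SL)
  let ?w = "monomial R d (shift d) f"
  have move: "elementary R d (shift d i) (shift d j) t \<in> K"
    if ij: "i < d" "j < d" "i \<noteq> j" and t: "t \<in> carrier R"
      and E': "\<And>s. s \<in> carrier R \<Longrightarrow> elementary R d i j s \<in> K" for i j t
  proof -
    have fi: "f i \<in> Units R" "f i \<in> carrier R" "f j \<in> carrier R" using f ij by (auto simp: field_Units)
    \<comment> \<open>The parameter at (i, j) that conjugation turns into t.\<close>
    define s where "s = inv (f i) \<otimes> (t \<otimes> f j)"
    have s: "s \<in> carrier R" using fi t by (simp add: s_def)
    have eq: "t \<otimes> f j = f i \<otimes> s" using fi t by (simp add: s_def m_assoc[symmetric])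
    let ?A = "elementary R d i j s" and ?B = "elementary R d (shift d i) (shift d j) t"
    have "shift d i \<noteq> shift d j" using permutes_inj[OF shift_permutes] ij by (simp add: inj_eq)
    then have B: "?B \<in> carrier (SL d R)"
      using ij t perm_lt[OF shift_permutes] by (intro elementary_SL) auto
    have A: "?A \<in> carrier (SL d R)" using ij s by (intro elementary_SL) auto
    have "?w \<otimes>\<^bsub>SL d R\<^esub> ?A = ?B \<otimes>\<^bsub>SL d R\<^esub> ?w"
      unfolding SL_simps(2)
      by (rule monomial_elementary[OF shift_permutes _ s t eq ij]) (use f in auto)
    then have "?B = ?w \<otimes>\<^bsub>SL d R\<^esub> ?A \<otimes>\<^bsub>SL d R\<^esub> inv\<^bsub>SL d R\<^esub> ?w"
      using A B w by (intro S.inv_solve_right[THEN iffD2]) simp_all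
    then show ?thesis using conj[OF E'[OF s]] by simp
  qed
  have succ: "Suc i < d \<Longrightarrow> s \<in> carrier R \<Longrightarrow> elementary R d i (Suc i) s \<in> K" for i s
  proof (induction i arbitrary: s)
    case 0
    then show ?case using E by simp
  next
    case (Suc i)
    then show ?case using move[of i "Suc i" s] by (simp add: shift_def)
  qed
  \<comment> \<open>The last adjacent position arises when (d - 2, d - 1) is moved across the end of
    the cycle.\<close>
  have wrap: "elementary R d (d - 1) 0 s \<in> K" if "s \<in> carrier R" for s
  proof -
    obtain m where m: "d = Suc (Suc m)" using d by (metis Suc_le_D numeral_2_eq_2 Suc_le_mono)
    then show ?thesis using move[of m "Suc m" s] succ[of m] that by (simp add: shift_def)
  qed
  have up: "elementary R d i (i + Suc n) s \<in> K" if "i + Suc n < d" "s \<in> carrier R" for i n s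
    using that
  proof (induction n arbitrary: s)
    case 0
    then show ?case using succ by simp
  next
    case (Suc n)
    show ?case
      by (rule elementary_in_subgroup_trans[OF K, of _ "i + Suc n"])
        (use Suc succ[of "i + Suc n"] in auto)
  qed
  then have up: "elementary R d i j s \<in> K" if "i < j" "j < d" "s \<in> carrier R" for i j s
    using that less_iff_Suc_add[of i j] by auto
  have col0: "elementary R d i 0 s \<in> K" if "0 < i" "i < d" "s \<in> carrier R" for i s
  proof (cases "i = d - 1")
    case False
    show ?thesis
      by (rule elementary_in_subgroup_trans[OF K, of _ "d - 1"]) (use False that up wrap in auto)
  qed (use wrap that in simp)
  show ?thesis
  proof (rule SL_generated_by_elementary[OF K])
    fix i j s assume ij: "i < d" "j < d" "i \<noteq> j" and s: "s \<in> carrier R"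
    show "elementary R d i j s \<in> K"
    proof (cases "i < j \<or> j = 0")
      case True
      then show ?thesis using up col0 ij s by auto
    next
      \<comment> \<open>Below the diagonal with j > 0, the path from i to j runs through 0.\<close>
      case False
      show ?thesis
        by (rule elementary_in_subgroup_trans[OF K, of _ 0]) (use False ij s up col0 in auto)
    qed
  qed
qed

text \<open>Each excluded equation would give a^m = 1 for m = 1, 2 or 3. The powers of a would then
  number at most 3, whereas at least 4 nonzero elements exist; this is the origin of the bound
  5.\<close>

lemma primitive_element:
  assumes fin: "finite (carrier R)" and q: "order R \<ge> 5"
  obtains a where "a \<in> carrier R" "a \<noteq> \<zero>"
    "\<And>s. s \<in> carrier R \<Longrightarrow> s \<noteq> \<zero> \<Longrightarrow> \<exists>n::nat. s = a [^] n"
    "a \<noteq> \<one>" "\<one> \<oplus> a \<noteq> \<zero>" "\<one> \<oplus> a \<oplus> a \<otimes> a \<noteq> \<zero>"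
proof -
  obtain a where a: "a \<in> carrier (Multiplicative_Group.mult_of R)"
    and gen: "carrier (Multiplicative_Group.mult_of R) = {a [^] i | i::nat. i \<in> UNIV}"
    using finite_field_mult_group_has_gen[OF fin] by (elim bexE)
  have aR: "a \<in> carrier R" "a \<noteq> \<zero>"
    using a by (simp_all add: Multiplicative_Group.carrier_mult_of)
  have card: "card (carrier R - {\<zero>}) = order R - 1"
    using fin by (simp add: order_def card_Diff_singleton)
  have small: "a [^] m \<noteq> \<one>" if m: "0 < m" "m < 4" for m :: nat
  proof
    assume e: "a [^] m = \<one>"
    have red: "a [^] i = a [^] (i mod m)" for i
    proof -
      have "a [^] i = a [^] (m * (i div m) + i mod m)" by simp
      also have "\<dots> = (a [^] m) [^] (i div m) \<otimes> a [^] (i mod m)"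
        using aR by (simp add: nat_pow_mult nat_pow_pow)
      finally show ?thesis using aR e by simp
    qed
    have "carrier R - {\<zero>} \<subseteq> (\<lambda>i. a [^] i) ` {..<m}"
    proof
      fix s assume "s \<in> carrier R - {\<zero>}"
      then obtain i :: nat where "s = a [^] i"
        using gen by (auto simp: Multiplicative_Group.carrier_mult_of)
      then have "s = a [^] (i mod m)" using red[of i] by (rule trans)
      then show "s \<in> (\<lambda>i. a [^] i) ` {..<m}" using m by auto
    qed
    then have "card (carrier R - {\<zero>}) \<le> m"
      using surj_card_le[of "{..<m}" "carrier R - {\<zero>}"] by simp
    then show False using card q m by linarith
  qed
  show ?thesis
  proof
    show "a \<in> carrier R" "a \<noteq> \<zero>" by (rule aR)+
    show "\<exists>n::nat. s = a [^] n" if "s \<in> carrier R" "s \<noteq> \<zero>" for s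
      using gen that by (auto simp: Multiplicative_Group.carrier_mult_of)
    show "a \<noteq> \<one>" using small[of 1] aR by simp
    show "\<one> \<oplus> a \<noteq> \<zero>"
    proof
      assume "\<one> \<oplus> a = \<zero>"
      then have "a = \<ominus> \<one>" using aR by (simp add: minus_equality a_comm)
      then have "a [^] (2::nat) = \<one>" by (simp add: numeral_2_eq_2 l_minus)
      then show False using small[of 2] by simp
    qed
    show "\<one> \<oplus> a \<oplus> a \<otimes> a \<noteq> \<zero>"
    proof
      assume z: "\<one> \<oplus> a \<oplus> a \<otimes> a = \<zero>"
      \<comment> \<open>Both sides are 1 + a + a^2 + a^3; cancelling the vanishing trinomial leaves
        a^3 = 1.\<close>
      have "a \<otimes> (\<one> \<oplus> a \<oplus> a \<otimes> a) \<oplus> \<one> = (\<one> \<oplus> a \<oplus> a \<otimes> a) \<oplus> a \<otimes> (a \<otimes> a)"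
        using aR by (simp add: r_distr a_ac)
      then have "a \<otimes> (a \<otimes> a) = \<one>" using aR by (simp add: z)
      then have "a [^] (3::nat) = \<one>" using aR(1) by (simp add: numeral_3_eq_3 m_assoc)
      then show False using small[of 3] by simp
    qed
  qed
qed

theorem SL_chiral_pair:
  assumes d: "d \<ge> 3" and fin: "finite (carrier R)" and q: "order R \<ge> 5"
  shows "\<exists>x y. chiral_pair (SL d R) x y"
proof -
  obtain a where aR: "a \<in> carrier R" "a \<noteq> \<zero>"
    and prim: "\<And>s. s \<in> carrier R \<Longrightarrow> s \<noteq> \<zero> \<Longrightarrow> \<exists>n::nat. s = a [^] n"
    and a: "a \<noteq> \<one>" "\<one> \<oplus> a \<noteq> \<zero>" "\<one> \<oplus> a \<oplus> a \<otimes> a \<noteq> \<zero>"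
    using primitive_element[OF fin q] by blast
  have aU: "a \<in> Units R" using aR by (simp add: field_Units)
  have ia: "inv a \<in> carrier R" "a \<otimes> inv a = \<one>" "inv a \<otimes> a = \<one>" using aU by simp_all
  interpret S: group "SL d R" by (rule group_SL)
  have prod: "(\<Otimes>c\<in>{..<d}. if c = m then a else if c = n then inv a else \<one>) = \<one>"
    if mn: "m < d" "n < d" "m \<noteq> n" for m n
  proof -
    let ?f = "\<lambda>c. if c = m then a else if c = n then inv a else \<one>"
    have "{..<d} = insert m (insert n ({..<d} - {m, n}))" using mn by auto
    then have "finprod R ?f {..<d} = finprod R ?f (insert m (insert n ({..<d} - {m, n})))" by simp
    also have "\<dots> = ?f m \<otimes> finprod R ?f (insert n ({..<d} - {m, n}))"
      by (rule finprod_insert) (use mn aR ia in auto)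
    also have "finprod R ?f (insert n ({..<d} - {m, n})) = ?f n \<otimes> finprod R ?f ({..<d} - {m, n})"
      by (rule finprod_insert) (use mn aR ia in auto)
    also have "finprod R ?f ({..<d} - {m, n}) = \<one>" by (rule finprod_one_eqI) auto
    finally show ?thesis using mn ia by simp
  qed
  define hf where "hf c = (if c = d - 1 then a else if c = 1 then inv a else \<one>)" for c
  \<comment> \<open>The diagonal of w x w^-1: the cycle carries the entries at d - 1 and 1 to the
    places 0 and 2.\<close>
  define kf where "kf c = (if c = 0 then a else if c = 2 then inv a else \<one>)" for c :: nat
  \<comment> \<open>The sign of the cycle, put into the last column, makes the determinant a square
    of a sign, hence one in every parity of d.\<close>
  define wf where "wf c = (if d - 1 = c then sign_over R (shift d) else \<one>)" for c
  let ?h = "monomial R d id hf" and ?k = "monomial R d id kf" and ?w = "monomial R d (shift d) wf"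
  let ?T = "elementary R d 0 1"
  have fc: "hf c \<in> carrier R" "kf c \<in> carrier R" "wf c \<in> carrier R" for c
    using aR ia by (simp_all add: hf_def kf_def wf_def sign_over_closed)
  have sgn0: "sign_over R (shift d) \<noteq> \<zero>" using sign_over_square[of "shift d"] by auto
  have h: "?h \<in> carrier (SL d R)"
    using prod[of "d - 1" 1] d aR ia unfolding SL_simps
    by (simp add: monomial_closed fc det_over_monomial permutes_id sign_over_def hf_def)
  have k: "?k \<in> carrier (SL d R)"
    using prod[of 0 2] d aR ia unfolding SL_simps
    by (simp add: monomial_closed fc det_over_monomial permutes_id sign_over_def kf_def)
  have w: "?w \<in> carrier (SL d R)"
  proof -
    have "(\<Otimes>c\<in>{..<d}. wf c) = sign_over R (shift d)"
      unfolding wf_def by (rule finprod_singleton) (use d in \<open>auto simp: sign_over_closed\<close>)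
    then show ?thesis
      unfolding SL_simps
      by (simp add: monomial_closed fc det_over_monomial[OF shift_permutes] sign_over_square)
  qed
  have lt: "0 < d" "1 < d" "(0::nat) \<noteq> 1" using d by auto
  interpret r: root_group "SL d R" R ?T a ?h ?k ?w
  proof unfold_locales
    show "?T s \<in> carrier (SL d R)" if "s \<in> carrier R" for s using that lt by (intro elementary_SL) auto
    show "?T s \<otimes>\<^bsub>SL d R\<^esub> ?T t = ?T (s \<oplus> t)" if "s \<in> carrier R" "t \<in> carrier R" for s t
      using that lt by (simp add: SL_simps(2) elementary_add)
    show "?h \<otimes>\<^bsub>SL d R\<^esub> ?T s = ?T (a \<otimes> s) \<otimes>\<^bsub>SL d R\<^esub> ?h" if s: "s \<in> carrier R" for s
    proof -
      have "hf 1 = inv a" "hf 0 = \<one>" using d by (auto simp: hf_def)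
      then have eq: "a \<otimes> s \<otimes> hf 1 = hf 0 \<otimes> s"
        using s aR(1) ia m_comm[of a s] by (simp add: m_assoc)
      have "mult_over R d ?h (?T s) = mult_over R d (elementary R d (id 0) (id 1) (a \<otimes> s)) ?h"
        by (rule monomial_elementary[OF permutes_id _ s _ eq lt]) (use s aR fc in auto)
      then show ?thesis by (simp only: SL_simps(2) id_apply)
    qed
    show "?k \<otimes>\<^bsub>SL d R\<^esub> ?T s = ?T (a \<otimes> s) \<otimes>\<^bsub>SL d R\<^esub> ?k" if s: "s \<in> carrier R" for s
    proof -
      have eq: "a \<otimes> s \<otimes> kf 1 = kf 0 \<otimes> s" using s aR(1) by (simp add: kf_def)
      have "mult_over R d ?k (?T s) = mult_over R d (elementary R d (id 0) (id 1) (a \<otimes> s)) ?k"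
        by (rule monomial_elementary[OF permutes_id _ s _ eq lt]) (use s aR fc in auto)
      then show ?thesis by (simp only: SL_simps(2) id_apply)
    qed
    show "?w \<otimes>\<^bsub>SL d R\<^esub> ?h = ?k \<otimes>\<^bsub>SL d R\<^esub> ?w"
      unfolding SL_simps(2) monomial_mult[OF shift_permutes permutes_id fc(3) fc(1)]
        monomial_mult[OF permutes_id shift_permutes fc(2) fc(3)]
    proof (rule monomial_cong)
      fix c assume "c < d"
      then have "kf (shift d c) = hf c" using d by (auto simp: kf_def hf_def shift_def)
      then show "wf (id c) \<otimes> hf c = kf (shift d c) \<otimes> wf c" by (simp add: m_comm fc)
    qed simp
    show "?h \<otimes>\<^bsub>SL d R\<^esub> ?k = ?k \<otimes>\<^bsub>SL d R\<^esub> ?h"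
      unfolding SL_simps(2) monomial_mult[OF permutes_id permutes_id fc(1) fc(2)]
        monomial_mult[OF permutes_id permutes_id fc(2) fc(1)]
      by (rule monomial_cong) (simp_all add: m_comm fc)
    show "K = carrier (SL d R)" if "subgroup K (SL d R)" "?T ` carrier R \<subseteq> K"
      "\<And>u. u \<in> K \<Longrightarrow> ?w \<otimes>\<^bsub>SL d R\<^esub> u \<otimes>\<^bsub>SL d R\<^esub> inv\<^bsub>SL d R\<^esub> ?w \<in> K" for K
      by (rule shift_closed_subgroup_full[OF _ that(1) _ w _ that(3)])
        (use that(2) d sgn0 fc in \<open>auto simp: wf_def\<close>)
  qed (use h k w aR prim a in auto)
  show ?thesis using r.chiral_pair_hy by blast
qed

end

section \<open>The centre, the projective group and the conclusion\<close>

lemma (in group) group_center_normal: "group_center G \<lhd> G"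
proof (rule normal_invI)
  show "subgroup (group_center G) G"
  proof (rule subgroupI)
    show "group_center G \<noteq> {}" by (auto simp: group_center_def intro!: exI[of _ "\<one>"])
    fix z assume z: "z \<in> group_center G"
    then have zc: "z \<in> carrier G" by (simp add: group_center_def)
    have "inv z \<otimes> g = g \<otimes> inv z" if g: "g \<in> carrier G" for g
    proof -
      have "z \<otimes> g = g \<otimes> z" using z g by (simp add: group_center_def)
      then show ?thesis using zc g by (metis inv_closed inv_solve_left inv_solve_right m_assoc m_closed)
    qed
    then show "inv z \<in> group_center G" using zc by (simp add: group_center_def)
    fix z' assume z': "z' \<in> group_center G"
    then have zc': "z' \<in> carrier G" by (simp add: group_center_def)
    have "z \<otimes> z' \<otimes> g = g \<otimes> (z \<otimes> z')" if g: "g \<in> carrier G" for g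
    proof -
      have "z \<otimes> g = g \<otimes> z" "z' \<otimes> g = g \<otimes> z'"
        using z z' g by (simp_all add: group_center_def)
      then show ?thesis using zc zc' g by (metis m_assoc m_closed)
    qed
    then show "z \<otimes> z' \<in> group_center G" using zc zc' by (simp add: group_center_def)
  qed (auto simp: group_center_def)
  show "g \<otimes> z \<otimes> inv g \<in> group_center G"
    if g: "g \<in> carrier G" and z: "z \<in> group_center G" for g z
  proof -
    have "g \<otimes> z = z \<otimes> g" "z \<in> carrier G" using g z by (simp_all add: group_center_def)
    then have "g \<otimes> z \<otimes> inv g = z" using g by (simp add: m_assoc)
    then show ?thesis using z by simp
  qed
qed

theorem theorem14:
  fixes d :: nat
  assumes "d \<ge> 3"
  shows "\<exists>Q::nat. \<forall>q::nat. primepow q \<and> q \<ge> Q \<longrightarrow>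
    (\<forall>F :: nat ring. field F \<and> order F = q \<longrightarrow>
       (\<exists>M :: nat hypermap. totally_chiral M \<and> Mon M \<cong> SL d F) \<and>
       (\<exists>M :: nat hypermap. totally_chiral M \<and> Mon M \<cong> PSL d F))"
proof (intro exI allI impI)
  fix q :: nat and F :: "nat ring"
  \<comment> \<open>This fixes the witness as 5, the bound of \<open>primitive_element\<close>, for
    every d.\<close>
  assume q: "primepow q \<and> q \<ge> 5" and "field F \<and> order F = q"
  then have F: "field F" and oF: "order F \<ge> 5" by auto
  interpret field F by (rule F)
  \<comment> \<open>The order of an infinite carrier is zero by convention, so the lower bound also
    yields finiteness.\<close>
  have fin: "finite (carrier F)" using oF by (auto simp: order_def intro: card_ge_0_finite)
  let ?S = "SL d F"
  interpret S: group ?S by (rule group_SL)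
  have finS: "finite (carrier ?S)"
    by (rule finite_subset[OF _ finite_mat_over[OF fin]]) (auto simp: SL_simps)
  obtain x y where xy: "chiral_pair ?S x y" using SL_chiral_pair[OF assms fin oF] by blast
  have Z: "group_center ?S \<lhd> ?S" by (rule S.group_center_normal)
  interpret Z: normal "group_center ?S" ?S by (rule Z)
  let ?p = "\<lambda>g. group_center ?S #>\<^bsub>?S\<^esub> g"
  have P: "group (PSL d F)" unfolding PSL_def by (rule Z.factorgroup_is_group)
  have hom: "group_hom ?S (PSL d F) ?p"
    by (rule group_hom.intro[OF S.group_axioms P group_hom_axioms.intro])
      (use Z.r_coset_hom_Mod in \<open>simp add: PSL_def\<close>)
  have surj: "?p ` carrier ?S = carrier (PSL d F)"
    by (auto simp: PSL_def FactGroup_def RCOSETS_def)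
  have finP: "finite (carrier (PSL d F))" unfolding surj[symmetric] by (rule finite_imageI[OF finS])
  show "(\<exists>M :: nat hypermap. totally_chiral M \<and> Mon M \<cong> ?S) \<and>
      (\<exists>M :: nat hypermap. totally_chiral M \<and> Mon M \<cong> PSL d F)"
    using S.chiral_pair_imp_totally_chiral[OF finS xy]
      group.chiral_pair_imp_totally_chiral[OF P finP chiral_pair_image[OF hom surj xy]] by (rule conjI)
qed

end
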